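(* Let $p:\mathcal D\to\mathcal C$ be a functor such that $\mathcal C$ is factorization preordered. Then every strongly multifocused derivation $\alpha$ (for $p$) has a unique normal form $\mathsf{NF}(\alpha)$ for the rewriting relation $\mathsf{par}\cup\mathsf{gra}$. Moreover, for any pair of strongly multifocused derivations $\alpha,\beta$ of the same sequent, $\alpha\sim_{\mathsf{seq}}\beta$ if and only if $\mathsf{NF}(\alpha)=\mathsf{NF}(\beta)$.
   Context: Composition is in diagrammatic order. A category $\mathcal C$ is factorization preordered if for all composable $f$, $g,h$ (parallel), $k$: $fg=fh$ and $gk=hk$ imply $g=h$. Formulas. Bifibrational formulas over $p:\mathcal D\to\mathcal C$ are generated by: each object $X$ of $\mathcal D$ is an atomic formula over $p(X)$; if $S$ is over $A$ and $f:A\to B$ then $f^+S$ is over $B$; if $T$ is over $C$ and $g:B\to C$ then $g^-T$ is over $B$. A formula is positive if its outermost connective is some $f^+$, negative if it is some $g^-$. For a non-empty sequence $\pi=(f_0,\dots,f_n)$ of composable arrows write $\pi^+S=f_n^+\cdots f_0^+S$ and $\pi^-S=f_0^-\cdots f_n^-S$; inside base arrows $\pi$ denotes the composite $f_0\cdots f_n$. Below $N,M$ range over non-positive formulas (atomic or negative) and $P,Q$ over non-negative formulas (atomic or positive). Every formula is uniquely an atom, or $\pi^+N$, or $\pi^-P$. Strongly multifocused derivations of sequents $S\Rightarrow_h T$ ($S$ over $A$, $T$ over $C$, $h:A\to C$) are generated by: - axioms $\delta:X\Rightarrow_f Y$ for $\delta:X\to Y$ in $\mathcal D$ with $p(\delta)=f$;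 - inversion rules: from $N\Rightarrow_{\pi f}P$ infer $\pi^+N\Rightarrow_f P$; from $N\Rightarrow_{f\rho}P$ infer $N\Rightarrow_f\rho^-P$; from $N\Rightarrow_{\pi f\rho}P$ infer $\pi^+N\Rightarrow_f\rho^-P$; - focusing rules: from $P\Rightarrow_f Q$ infer $\sigma^-P\Rightarrow_{\sigma f}Q$, written $\mathsf L^-_\sigma$; from $N\Rightarrow_f M$ infer $N\Rightarrow_{f\tau}\tau^+M$, written $\mathsf R^+_\tau$; from $P\Rightarrow_f N$ infer $\sigma^-P\Rightarrow_{\sigma f\tau}\tau^+N$, written $\mathsf{LR}_{\sigma,\tau}$. Write $\mathsf{Inv}_{\pi,f,\rho}$ for the inversion step from $N\Rightarrow_{\pi f\rho}P$ to $\pi^+N\Rightarrow_f\rho^-P$, where $\pi$ or $\rho$ may be the empty sequence $\epsilon$ (so $\epsilon^{\pm}S=S$, composite an identity), giving the one-sided rules, or no rule at all when both are empty. In the rewriting rules below, $\pi$ (resp. $\rho$) in an inversion step that follows (is placed below) its premise may be empty exactly when the corresponding left (resp. right) formula is atomic; in one-sided steps $\mathsf{Inv}_{\pi,f,\epsilon}$, $\mathsf{Inv}_{\epsilon,f,\rho}$ the other side is simply left untouched. Rewriting rules (read with the conclusion outermost, applied anywhere inside a derivation; $\beta$ denotes an arbitrary derivation such that both sides are valid): - $\mathsf{par}$: $\ \mathsf L^-_\sigma\,\mathsf{Inv}_{\pi,f\tau,\epsilon}\,\mathsf R^+_\tau\,\mathsf{Inv}_{\epsilon,\pi f,\rho}\,\beta\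 \to\ \mathsf{LR}_{\sigma,\tau}\,\mathsf{Inv}_{\pi,f,\rho}\,\beta$ and $\ \mathsf R^+_\tau\,\mathsf{Inv}_{\epsilon,\sigma f,\rho}\,\mathsf L^-_\sigma\,\mathsf{Inv}_{\pi,f\rho,\epsilon}\,\beta\ \to\ \mathsf{LR}_{\sigma,\tau}\,\mathsf{Inv}_{\pi,f,\rho}\,\beta$, where $\beta$ is over $\pi f\rho$. - $\mathsf{gra}$: $\ \mathsf L^-_e\,\mathsf{Inv}_{b',gd,\epsilon}\,\mathsf{LR}_{b,d}\,\mathsf{Inv}_{a,f,c}\,\beta\ \to\ \mathsf{LR}_{e,d}\,\mathsf{Inv}_{b',g,c}\,\mathsf L^-_b\,\mathsf{Inv}_{a,fc,\epsilon}\,\beta$ whenever $bf=b'g$; and $\ \mathsf R^+_e\,\mathsf{Inv}_{\epsilon,bg,d'}\,\mathsf{LR}_{b,d}\,\mathsf{Inv}_{a,f,c}\,\beta\ \to\ \mathsf{LR}_{b,e}\,\mathsf{Inv}_{a,g,d'}\,\mathsf R^+_d\,\mathsf{Inv}_{\epsilon,af,c}\,\beta$ whenever $fd=gd'$; here $\beta$ is over $afc$. Sequentialization equivalence $\sim_{\mathsf{seq}}$ is the least equivalence relation on derivations of each sequent closed under the derivation rules and containing both $\mathsf{par}$ rules. A normal form is a derivation to which no rule of $\mathsf{par}\cup\mathsf{gra}$ applies; a normal form of $\alpha$ is one reachable from $\alpha$ by finitely many rewriting steps. *)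

theory Defs
  imports Main
begin

section \<open>Categories and functors\<close>

text \<open>Categories have a set of objects and a set of arrows; \<open>Comp C f g\<close> is the composite in
  diagrammatic order (first \<open>f\<close>, then \<open>g\<close>) and is meaningful only when \<open>Cod C f = Dom C g\<close>.\<close>

record ('o, 'a) category_data =
  Obj :: "'o set"
  Arr :: "'a set"
  Dom :: "'a \<Rightarrow> 'o"
  Cod :: "'a \<Rightarrow> 'o"
  Ide :: "'o \<Rightarrow> 'a"
  Comp :: "'a \<Rightarrow> 'a \<Rightarrow> 'a"

definition hom :: "('o, 'a) category_data \<Rightarrow> 'o \<Rightarrow> 'o \<Rightarrow> 'a set" where
  "hom C A B = {f \<in> Arr C. Dom C f = A \<and> Cod C f = B}"

locale category =
  fixes C :: "('o, 'a) category_data"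
  assumes Dom_closed: "f \<in> Arr C \<Longrightarrow> Dom C f \<in> Obj C"
    and Cod_closed: "f \<in> Arr C \<Longrightarrow> Cod C f \<in> Obj C"
    and Ide_hom: "A \<in> Obj C \<Longrightarrow> Ide C A \<in> hom C A A"
    and Comp_hom: "f \<in> hom C A B \<Longrightarrow> g \<in> hom C B E \<Longrightarrow> Comp C f g \<in> hom C A E"
    and Comp_Ide_left: "f \<in> hom C A B \<Longrightarrow> Comp C (Ide C A) f = f"
    and Comp_Ide_right: "f \<in> hom C A B \<Longrightarrow> Comp C f (Ide C B) = f"
    and Comp_assoc: "f \<in> hom C A B \<Longrightarrow> g \<in> hom C B E \<Longrightarrow> h \<in> hom C E F \<Longrightarrow>
      Comp C (Comp C f g) h = Comp C f (Comp C g h)"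

definition factorization_preordered :: "('o, 'a) category_data \<Rightarrow> bool" where
  "factorization_preordered C \<longleftrightarrow>
    (\<forall>W X Y Z. \<forall>f \<in> hom C W X. \<forall>g \<in> hom C X Y. \<forall>h \<in> hom C X Y. \<forall>k \<in> hom C Y Z.
      Comp C f g = Comp C f h \<and> Comp C g k = Comp C h k \<longrightarrow> g = h)"

record ('x, 'd, 'o, 'a) functor_data =
  source :: "('x, 'd) category_data"
  target :: "('o, 'a) category_data"
  omap :: "'x \<Rightarrow> 'o"
  amap :: "'d \<Rightarrow> 'a"

locale cat_functor =
  source: category "source p" + target: category "target p"
  for p :: "('x, 'd, 'o, 'a) functor_data" +
  assumes omap_closed: "X \<in> Obj (source p) \<Longrightarrow> omap p X \<in> Obj (target p)"
    and amap_hom: "\<delta> \<in> hom (source p) X Y \<Longrightarrow> amap p \<delta> \<in> hom (target p) (omap p X) (omap p Y)"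
    and amap_Ide: "X \<in> Obj (source p) \<Longrightarrow> amap p (Ide (source p) X) = Ide (target p) (omap p X)"
    and amap_Comp: "\<delta> \<in> hom (source p) X Y \<Longrightarrow> \<epsilon> \<in> hom (source p) Y Z \<Longrightarrow>
      amap p (Comp (source p) \<delta> \<epsilon>) = Comp (target p) (amap p \<delta>) (amap p \<epsilon>)"

section \<open>Formulas and sequents\<close>

text \<open>\<open>Push f S\<close> is \<open>f\<^sup>+ S\<close> and \<open>Pull g T\<close> is \<open>g\<^sup>- T\<close>.\<close>

datatype ('x, 'a) formula =
    Atom 'x
  | Push 'a "('x, 'a) formula"
  | Pull 'a "('x, 'a) formula"

inductive over :: "('x, 'd, 'o, 'a) functor_data \<Rightarrow> ('x, 'a) formula \<Rightarrow> 'o \<Rightarrow> bool"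
  for p :: "('x, 'd, 'o, 'a) functor_data" where
  over_Atom: "X \<in> Obj (source p) \<Longrightarrow> over p (Atom X) (omap p X)"
| over_Push: "over p S A \<Longrightarrow> f \<in> hom (target p) A B \<Longrightarrow> over p (Push f S) B"
| over_Pull: "over p T B \<Longrightarrow> g \<in> hom (target p) A B \<Longrightarrow> over p (Pull g T) A"

fun nonpositive :: "('x, 'a) formula \<Rightarrow> bool" where
  "nonpositive (Atom X) = True"
| "nonpositive (Push f S) = False"
| "nonpositive (Pull g T) = True"

fun nonnegative :: "('x, 'a) formula \<Rightarrow> bool" where
  "nonnegative (Atom X) = True"
| "nonnegative (Push f S) = True"
| "nonnegative (Pull g T) = False"

text \<open>For \<open>\<pi> = [f\<^sub>0, \<dots>, f\<^sub>n]\<close>, \<open>pushes \<pi> S\<close> is \<open>f\<^sub>n\<^sup>+ \<dots> f\<^sub>0\<^sup>+ S\<close> and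
  \<open>pulls \<pi> S\<close> is \<open>f\<^sub>0\<^sup>- \<dots> f\<^sub>n\<^sup>- S\<close>.\<close>

definition pushes :: "'a list \<Rightarrow> ('x, 'a) formula \<Rightarrow> ('x, 'a) formula" where
  "pushes \<pi> S = fold Push \<pi> S"

definition pulls :: "'a list \<Rightarrow> ('x, 'a) formula \<Rightarrow> ('x, 'a) formula" where
  "pulls \<pi> S = foldr Pull \<pi> S"

text \<open>\<open>precomp p \<pi> f\<close> and \<open>postcomp p f \<rho>\<close> are the base arrows \<open>\<pi> f\<close> and \<open>f \<rho>\<close>, composed one
  arrow at a time starting from \<open>f\<close>.  The empty sequence thus contributes nothing, which agrees
  with composing with an identity and avoids recording the object at which it sits.\<close>

definition precomp :: "('x, 'd, 'o, 'a) functor_data \<Rightarrow> 'a list \<Rightarrow> 'a \<Rightarrow> 'a" where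
  "precomp p \<pi> f = foldr (Comp (target p)) \<pi> f"

definition postcomp :: "('x, 'd, 'o, 'a) functor_data \<Rightarrow> 'a \<Rightarrow> 'a list \<Rightarrow> 'a" where
  "postcomp p f \<rho> = foldl (Comp (target p)) f \<rho>"

text \<open>\<open>Sequent S h T\<close> is \<open>S \<Rightarrow>\<^sub>h T\<close>.\<close>

datatype ('x, 'a) sequent = Sequent "('x, 'a) formula" 'a "('x, 'a) formula"

fun wf_sequent :: "('x, 'd, 'o, 'a) functor_data \<Rightarrow> ('x, 'a) sequent \<Rightarrow> bool" where
  "wf_sequent p (Sequent S h T) \<longleftrightarrow>
    (\<exists>A B. over p S A \<and> over p T B \<and> h \<in> hom (target p) A B)"

section \<open>Strongly multifocused derivations\<close>

text \<open>Every rule has one premise, so a derivation is an axiom followed by a list of rule instances.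
  The label of an instance determines its conclusion from its premise.  Inversion labels carry
  the base arrow \<open>f\<close> of the conclusion, which the premise \<open>N \<Rightarrow>\<^bsub>\<pi>f\<rho>\<^esub> P\<close> does not determine.\<close>

datatype 'a rule =
    Inv "'a list" 'a "'a list"
  | FocL "'a list"
  | FocR "'a list"
  | FocLR "'a list" "'a list"

datatype ('d, 'a) derivation =
    Axiom 'd
  | Infer "'a rule" "('d, 'a) derivation"

text \<open>\<open>inference p r s s'\<close>: the rule instance \<open>r\<close> has premise \<open>s\<close> and conclusion \<open>s'\<close>.
  Well-formedness of both sequents forces the sequences of arrows to be composable and to have the
  right endpoints.  The clause \<open>infer_Inv\<close> comprises the two-sided inversion rule and, when one
  of \<open>\<pi>\<close>, \<open>\<rho>\<close> is empty, the two one-sided ones.\<close>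

inductive inference ::
  "('x, 'd, 'o, 'a) functor_data \<Rightarrow> 'a rule \<Rightarrow> ('x, 'a) sequent \<Rightarrow> ('x, 'a) sequent \<Rightarrow> bool"
  for p :: "('x, 'd, 'o, 'a) functor_data" where
  infer_Inv:
    "\<lbrakk>\<pi> \<noteq> [] \<or> \<rho> \<noteq> []; nonpositive N; nonnegative P;
      s = Sequent N (postcomp p (precomp p \<pi> f) \<rho>) P; s' = Sequent (pushes \<pi> N) f (pulls \<rho> P);
      wf_sequent p s; wf_sequent p s'\<rbrakk>
     \<Longrightarrow> inference p (Inv \<pi> f \<rho>) s s'"
| infer_FocL:
    "\<lbrakk>\<sigma> \<noteq> []; nonnegative P; nonnegative Q;
      s = Sequent P f Q; s' = Sequent (pulls \<sigma> P) (precomp p \<sigma> f) Q;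
      wf_sequent p s; wf_sequent p s'\<rbrakk>
     \<Longrightarrow> inference p (FocL \<sigma>) s s'"
| infer_FocR:
    "\<lbrakk>\<tau> \<noteq> []; nonpositive N; nonpositive M;
      s = Sequent N f M; s' = Sequent N (postcomp p f \<tau>) (pushes \<tau> M);
      wf_sequent p s; wf_sequent p s'\<rbrakk>
     \<Longrightarrow> inference p (FocR \<tau>) s s'"
| infer_FocLR:
    "\<lbrakk>\<sigma> \<noteq> []; \<tau> \<noteq> []; nonnegative P; nonpositive N;
      s = Sequent P f N;
      s' = Sequent (pulls \<sigma> P) (postcomp p (precomp p \<sigma> f) \<tau>) (pushes \<tau> N);
      wf_sequent p s; wf_sequent p s'\<rbrakk>
     \<Longrightarrow> inference p (FocLR \<sigma> \<tau>) s s'"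

inductive derives ::
  "('x, 'd, 'o, 'a) functor_data \<Rightarrow> ('d, 'a) derivation \<Rightarrow> ('x, 'a) sequent \<Rightarrow> bool"
  for p :: "('x, 'd, 'o, 'a) functor_data" where
  derives_Axiom:
    "\<delta> \<in> hom (source p) X Y \<Longrightarrow>
     derives p (Axiom \<delta>) (Sequent (Atom X) (amap p \<delta>) (Atom Y))"
| derives_Infer:
    "derives p \<alpha> s \<Longrightarrow> inference p r s s' \<Longrightarrow> derives p (Infer r \<alpha>) s'"

section \<open>Rewriting\<close>

text \<open>An inversion step with both sequences empty is no step at all.\<close>

definition inv_step ::
  "'a list \<Rightarrow> 'a \<Rightarrow> 'a list \<Rightarrow> ('d, 'a) derivation \<Rightarrow> ('d, 'a) derivation" where
  "inv_step \<pi> f \<rho> \<beta> = (if \<pi> = [] \<and> \<rho> = [] then \<beta> else Infer (Inv \<pi> f \<rho>) \<beta>)"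

text \<open>That both sides are valid derivations is required where the schemas are used;
  it entails that a sequence in an inversion step is empty only if the formula it would act on is
  atomic, since the focusing rule below rejects a premise with a formula of the wrong polarity.\<close>

inductive par_rule ::
  "('x, 'd, 'o, 'a) functor_data \<Rightarrow> ('d, 'a) derivation \<Rightarrow> ('d, 'a) derivation \<Rightarrow> bool"
  for p :: "('x, 'd, 'o, 'a) functor_data" where
  par_L:
    "derives p \<beta> (Sequent N (postcomp p (precomp p \<pi> f) \<rho>) P) \<Longrightarrow>
     par_rule p
       (Infer (FocL \<sigma>) (inv_step \<pi> (postcomp p f \<tau>) []
         (Infer (FocR \<tau>) (inv_step [] (precomp p \<pi> f) \<rho> \<beta>))))
       (Infer (FocLR \<sigma> \<tau>) (inv_step \<pi> f \<rho> \<beta>))"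
| par_R:
    "derives p \<beta> (Sequent N (postcomp p (precomp p \<pi> f) \<rho>) P) \<Longrightarrow>
     par_rule p
       (Infer (FocR \<tau>) (inv_step [] (precomp p \<sigma> f) \<rho>
         (Infer (FocL \<sigma>) (inv_step \<pi> (postcomp p f \<rho>) [] \<beta>))))
       (Infer (FocLR \<sigma> \<tau>) (inv_step \<pi> f \<rho> \<beta>))"

inductive gra_rule ::
  "('x, 'd, 'o, 'a) functor_data \<Rightarrow> ('d, 'a) derivation \<Rightarrow> ('d, 'a) derivation \<Rightarrow> bool"
  for p :: "('x, 'd, 'o, 'a) functor_data" where
  gra_L:
    "derives p \<beta> (Sequent N (postcomp p (precomp p a f) c) P) \<Longrightarrow>
     precomp p b f = precomp p b' g \<Longrightarrow>
     gra_rule p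
       (Infer (FocL e) (inv_step b' (postcomp p g d) []
         (Infer (FocLR b d) (inv_step a f c \<beta>))))
       (Infer (FocLR e d) (inv_step b' g c
         (Infer (FocL b) (inv_step a (postcomp p f c) [] \<beta>))))"
| gra_R:
    "derives p \<beta> (Sequent N (postcomp p (precomp p a f) c) P) \<Longrightarrow>
     postcomp p f d = postcomp p g d' \<Longrightarrow>
     gra_rule p
       (Infer (FocR e) (inv_step [] (precomp p b g) d'
         (Infer (FocLR b d) (inv_step a f c \<beta>))))
       (Infer (FocLR b e) (inv_step a g d'
         (Infer (FocR d) (inv_step [] (precomp p a f) c \<beta>))))"

inductive rewrite_step ::
  "('x, 'd, 'o, 'a) functor_data \<Rightarrow> ('d, 'a) derivation \<Rightarrow> ('d, 'a) derivation \<Rightarrow> bool"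
  for p :: "('x, 'd, 'o, 'a) functor_data" where
  rewrite_root:
    "par_rule p \<alpha> \<beta> \<or> gra_rule p \<alpha> \<beta> \<Longrightarrow> derives p \<alpha> s \<Longrightarrow> derives p \<beta> s \<Longrightarrow> rewrite_step p \<alpha> \<beta>"
| rewrite_Infer:
    "rewrite_step p \<alpha> \<beta> \<Longrightarrow> rewrite_step p (Infer r \<alpha>) (Infer r \<beta>)"

definition normal_form :: "('x, 'd, 'o, 'a) functor_data \<Rightarrow> ('d, 'a) derivation \<Rightarrow> bool" where
  "normal_form p \<nu> \<longleftrightarrow> (\<exists>s. derives p \<nu> s) \<and> \<not> (\<exists>\<mu>. rewrite_step p \<nu> \<mu>)"

definition normal_form_of ::
  "('x, 'd, 'o, 'a) functor_data \<Rightarrow> ('d, 'a) derivation \<Rightarrow> ('d, 'a) derivation \<Rightarrow> bool" where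
  "normal_form_of p \<alpha> \<nu> \<longleftrightarrow> (rewrite_step p)\<^sup>*\<^sup>* \<alpha> \<nu> \<and> normal_form p \<nu>"

definition NF ::
  "('x, 'd, 'o, 'a) functor_data \<Rightarrow> ('d, 'a) derivation \<Rightarrow> ('d, 'a) derivation" where
  "NF p \<alpha> = (THE \<nu>. normal_form_of p \<alpha> \<nu>)"

text \<open>\<open>seq_equiv p s\<close> is sequentialization equivalence on the derivations of \<open>s\<close>.\<close>

inductive seq_equiv ::
  "('x, 'd, 'o, 'a) functor_data \<Rightarrow> ('x, 'a) sequent \<Rightarrow>
   ('d, 'a) derivation \<Rightarrow> ('d, 'a) derivation \<Rightarrow> bool"
  for p :: "('x, 'd, 'o, 'a) functor_data" where
  seq_par:
    "par_rule p \<alpha> \<beta> \<Longrightarrow> derives p \<alpha> s \<Longrightarrow> derives p \<beta> s \<Longrightarrow> seq_equiv p s \<alpha> \<beta>"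
| seq_Infer:
    "seq_equiv p s \<alpha> \<beta> \<Longrightarrow> inference p r s s' \<Longrightarrow> seq_equiv p s' (Infer r \<alpha>) (Infer r \<beta>)"
| seq_refl: "derives p \<alpha> s \<Longrightarrow> seq_equiv p s \<alpha> \<alpha>"
| seq_sym: "seq_equiv p s \<alpha> \<beta> \<Longrightarrow> seq_equiv p s \<beta> \<alpha>"
| seq_trans: "seq_equiv p s \<alpha> \<beta> \<Longrightarrow> seq_equiv p s \<beta> \<gamma> \<Longrightarrow> seq_equiv p s \<alpha> \<gamma>"

end

theory Submission
  imports Defs
begin

text \<open>The relation \<open>par \<union> gra\<close> terminates and is locally confluent; as in Newman's lemma, normal forms
  therefore exist and are unique.

  Inversion steps are determined by the conclusion they derive, so a derivation is essentially a
  word of focusing steps, each with a choice of base arrow.  Write \<open>L\<close>, \<open>R\<close>, \<open>LR\<close> for a focusing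
  step together with the inversion step above it (\<open>stepL\<close>, \<open>stepR\<close>, \<open>stepLR\<close>), and read words
  from the conclusion upwards.  Then \<open>par\<close> rewrites \<open>L R\<close> and
  \<open>R L\<close> to \<open>LR\<close>, while \<open>gra\<close> rewrites \<open>L LR\<close> to \<open>LR L\<close> and \<open>R LR\<close> to \<open>LR R\<close>.  Termination
  (\<open>weight_rewrite\<close>) follows from a weight that \<open>L\<close> and \<open>R\<close> double and \<open>LR\<close> increments.

  The key observation is that \<open>gra\<close> is an instance of the completion of \<open>par\<close>.  A step
  \<open>L LR \<rightarrow> LR L\<close> exists exactly when \<open>LR\<close>, unfolded backwards to \<open>R L\<close>, makes the resulting
  \<open>L R L\<close> a redex of \<open>par\<close> in its first two steps (\<open>typed_gra_L\<close>, \<open>root_step_iff\<close>).  Consequences: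

  \<^item> \<open>gra\<close> is contained in sequentialization equivalence (\<open>rewrite_seq_equiv\<close>), so that this
    equivalence is the one generated by rewriting.

  \<^item> A redex determines its contractum (\<open>root_step_functional\<close>).  For \<open>par\<close> this is where factorization
    preorderedness enters: the arrow \<open>f\<close> of the contractum is known only through the composites
    \<open>\<pi> f\<close> and \<open>f \<tau>\<close> (\<open>typed_par_L_functional\<close>).  A word \<open>LR\<close>, on the other hand, determines its
    unfoldings \<open>L R\<close> and \<open>R L\<close>, which settles \<open>gra\<close>.

  \<^item> Up to mirror symmetry the only overlaps of redexes are \<open>L R L\<close> and \<open>L R LR\<close>.  The first is joined
    by the very definition of \<open>gra\<close>; in the second, unfolding the final \<open>LR\<close> reduces the
    question to the first (\<open>typed_par_L_peak\<close>).  No computation with base arrows is needed.\<close>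

section \<open>Composites of sequences of arrows\<close>

text \<open>\<open>path C A \<pi> B\<close> says that \<open>\<pi>\<close> is a composable sequence of arrows from \<open>A\<close> to \<open>B\<close>; the empty
  sequence is a path from \<open>A\<close> to \<open>A\<close> for every \<open>A\<close>, object of \<open>C\<close> or not.\<close>

fun path :: "('o, 'a) category_data \<Rightarrow> 'o \<Rightarrow> 'a list \<Rightarrow> 'o \<Rightarrow> bool" where
  "path C A [] B \<longleftrightarrow> A = B"
| "path C A (f # \<pi>) B \<longleftrightarrow> (\<exists>E. f \<in> hom C A E \<and> path C E \<pi> B)"

lemma hom_unique: "f \<in> hom C A B \<Longrightarrow> f \<in> hom C A' B' \<Longrightarrow> A = A' \<and> B = B'"
  by (auto simp: hom_def)

lemma path_source_unique: "\<pi> \<noteq> [] \<Longrightarrow> path C A \<pi> B \<Longrightarrow> path C A' \<pi> B' \<Longrightarrow> A = A'"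
  by (cases \<pi>) (auto dest: hom_unique)

lemma path_target_unique: "path C A \<pi> B \<Longrightarrow> path C A \<pi> B' \<Longrightarrow> B = B'"
  by (induction \<pi> arbitrary: A) (auto dest: hom_unique)

lemma precomp_simps [simp]:
  "precomp p [] f = f" "precomp p (g # \<pi>) f = Comp (target p) g (precomp p \<pi> f)"
  by (simp_all add: precomp_def)

lemma postcomp_simps [simp]:
  "postcomp p f [] = f" "postcomp p f (g # \<pi>) = postcomp p (Comp (target p) f g) \<pi>"
  by (simp_all add: postcomp_def)

lemma pulls_simps [simp]: "pulls [] T = T" "pulls (g # \<pi>) T = Pull g (pulls \<pi> T)"
  by (simp_all add: pulls_def)

lemma pushes_simps [simp]: "pushes [] T = T" "pushes (g # \<pi>) T = pushes \<pi> (Push g T)"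
  by (simp_all add: pushes_def)

lemma pushes_append [simp]: "pushes (\<pi> @ \<pi>') T = pushes \<pi>' (pushes \<pi> T)"
  by (simp add: pushes_def)

lemma polarity_simps [simp]:
  "nonnegative (pulls \<rho> P) \<longleftrightarrow> \<rho> = [] \<and> nonnegative P"
  "nonpositive (pulls \<rho> P) \<longleftrightarrow> \<rho> \<noteq> [] \<or> nonpositive P"
  "nonpositive (pushes \<rho> P) \<longleftrightarrow> \<rho> = [] \<and> nonpositive P"
  "nonnegative (pushes \<rho> P) \<longleftrightarrow> \<rho> \<noteq> [] \<or> nonnegative P"
     apply (cases \<rho>; simp)
    apply (cases \<rho>; simp)
   apply (cases \<rho> rule: rev_cases; simp)
  apply (cases \<rho> rule: rev_cases; simp)
  done

inductive_simps over_iff: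
  "over p (Atom X) A" "over p (Pull g T) A" "over p (Push f S) A"

lemma over_unique: "over p S A \<Longrightarrow> over p S B \<Longrightarrow> A = B"
  by (cases S) (auto simp: over_iff hom_def)

lemma over_pulls: "over p (pulls \<sigma> T) A \<longleftrightarrow> (\<exists>B. over p T B \<and> path (target p) A \<sigma> B)"
  by (induction \<sigma> arbitrary: A) (auto simp: over_iff)

lemma over_pushes: "over p (pushes \<pi> S) B \<longleftrightarrow> (\<exists>A. over p S A \<and> path (target p) A \<pi> B)"
  by (induction \<pi> arbitrary: S) (auto simp: over_iff)

context cat_functor
begin

lemma precomp_hom:
  "path (target p) A \<pi> B \<Longrightarrow> f \<in> hom (target p) B E \<Longrightarrow> precomp p \<pi> f \<in> hom (target p) A E"
  by (induction \<pi> arbitrary: A) (auto intro: target.Comp_hom)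

lemma postcomp_hom:
  "path (target p) B \<rho> E \<Longrightarrow> f \<in> hom (target p) A B \<Longrightarrow> postcomp p f \<rho> \<in> hom (target p) A E"
  by (induction \<rho> arbitrary: f B) (auto intro: target.Comp_hom)

lemma precomp_Comp:
  "path (target p) A \<pi> B \<Longrightarrow> f \<in> hom (target p) B E \<Longrightarrow> g \<in> hom (target p) E F \<Longrightarrow>
   precomp p \<pi> (Comp (target p) f g) = Comp (target p) (precomp p \<pi> f) g"
proof (induction \<pi> arbitrary: A)
  case (Cons a \<pi>)
  then obtain A' where "a \<in> hom (target p) A A'" "path (target p) A' \<pi> B"
    by auto
  with Cons show ?case
    by (simp add: target.Comp_assoc[OF _ precomp_hom])
qed simp

lemma postcomp_Comp:
  "g \<in> hom (target p) A B \<Longrightarrow> f \<in> hom (target p) B E \<Longrightarrow> path (target p) E \<rho> F \<Longrightarrow>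
   postcomp p (Comp (target p) g f) \<rho> = Comp (target p) g (postcomp p f \<rho>)"
proof (induction \<rho> arbitrary: f E)
  case (Cons a \<rho>)
  then obtain E' where a: "a \<in> hom (target p) E E'" "path (target p) E' \<rho> F"
    by auto
  have "Comp (target p) f a \<in> hom (target p) B E'"
    using Cons.prems a target.Comp_hom by blast
  with Cons.IH Cons.prems a show ?case
    by (simp add: target.Comp_assoc)
qed simp

lemma postcomp_precomp:
  "path (target p) A \<pi> B \<Longrightarrow> f \<in> hom (target p) B E \<Longrightarrow> path (target p) E \<rho> F \<Longrightarrow>
   postcomp p (precomp p \<pi> f) \<rho> = precomp p \<pi> (postcomp p f \<rho>)"
proof (induction \<pi> arbitrary: A)
  case (Cons a \<pi>)
  then obtain A' where "a \<in> hom (target p) A A'" "path (target p) A' \<pi> B"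
    by auto
  with Cons show ?case
    by (simp add: postcomp_Comp[OF _ precomp_hom])
qed simp

lemma path_cancel:
  assumes "factorization_preordered (target p)"
    and "path (target p) A \<pi> B" "f \<in> hom (target p) B E" "g \<in> hom (target p) B E"
    and "path (target p) E \<tau> F"
    and "precomp p \<pi> f = precomp p \<pi> g" "postcomp p f \<tau> = postcomp p g \<tau>"
  shows "f = g"
proof -
  have ide: "Ide (target p) B \<in> hom (target p) B B" "Ide (target p) E \<in> hom (target p) E E"
    using assms(3) target.Dom_closed target.Cod_closed target.Ide_hom by (auto simp: hom_def)
  have pre: "precomp p \<pi> h = Comp (target p) (precomp p \<pi> (Ide (target p) B)) h"
    and post: "postcomp p h \<tau> = Comp (target p) h (postcomp p (Ide (target p) E) \<tau>)"
    if "h \<in> hom (target p) B E" for h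
    using precomp_Comp[OF assms(2) ide(1) that] postcomp_Comp[OF that ide(2) assms(5)] that
    by (simp_all add: target.Comp_Ide_left target.Comp_Ide_right)
  show ?thesis
    using assms(1) precomp_hom[OF assms(2) ide(1)] postcomp_hom[OF assms(5) ide(2)]
      assms(3,4,6,7) pre post
    unfolding factorization_preordered_def by metis
qed

section \<open>Derivations up to inversion\<close>

lemma derives_wf: "derives p \<alpha> s \<Longrightarrow> wf_sequent p s"
proof (induction rule: derives.induct)
  case (derives_Axiom \<delta> X Y)
  then have "X \<in> Obj (source p)" "Y \<in> Obj (source p)"
    using source.Dom_closed source.Cod_closed by (auto simp: hom_def)
  with amap_hom[OF derives_Axiom] show ?case
    by (auto intro!: over_Atom)
qed (auto elim: inference.cases)

lemma derives_AxiomE: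
  "derives p (Axiom \<delta>) s \<Longrightarrow>
    (\<And>X Y. \<delta> \<in> hom (source p) X Y \<Longrightarrow> s = Sequent (Atom X) (amap p \<delta>) (Atom Y) \<Longrightarrow> thesis) \<Longrightarrow> thesis"
  by (auto elim: derives.cases)

lemma derives_InferE:
  "derives p (Infer r \<alpha>) s' \<Longrightarrow>
    (\<And>s. derives p \<alpha> s \<Longrightarrow> inference p r s s' \<Longrightarrow> thesis) \<Longrightarrow> thesis"
  by (auto elim: derives.cases)

lemma inference_functional: "inference p r s s1 \<Longrightarrow> inference p r s s2 \<Longrightarrow> s1 = s2"
  by (erule inference.cases; erule inference.cases; simp)

lemma derives_functional: "derives p \<alpha> s \<Longrightarrow> derives p \<alpha> s' \<Longrightarrow> s = s'"
proof (induction arbitrary: s' rule: derives.induct)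
  case (derives_Axiom \<delta> X Y)
  then show ?case by (auto elim!: derives_AxiomE dest: hom_unique)
next
  case (derives_Infer \<alpha> s r s')
  then show ?case by (metis derives_InferE inference_functional)
qed

lemma derives_Infer_cong:
  "(\<And>t. derives p \<alpha> t \<Longrightarrow> derives p \<beta> t) \<Longrightarrow> derives p (Infer r \<alpha>) s \<Longrightarrow> derives p (Infer r \<beta>) s"
  by (auto elim!: derives_InferE intro: derives_Infer)

lemma inv_step_Nil [simp]: "inv_step [] f [] \<beta> = \<beta>"
  by (simp add: inv_step_def)

lemma derives_inv_step_cong:
  "(\<And>t. derives p \<alpha> t \<Longrightarrow> derives p \<beta> t) \<Longrightarrow> derives p (inv_step \<pi> f \<rho> \<alpha>) s \<Longrightarrow>
   derives p (inv_step \<pi> f \<rho> \<beta>) s"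
  by (auto simp: inv_step_def intro: derives_Infer_cong split: if_splits)

text \<open>A focusing step together with the inversion step above it, which is absent when both of its
  sequences are empty.\<close>

abbreviation stepL where "stepL \<sigma> \<pi> x \<alpha> \<equiv> Infer (FocL \<sigma>) (inv_step \<pi> x [] \<alpha>)"
abbreviation stepR where "stepR \<tau> \<rho> y \<alpha> \<equiv> Infer (FocR \<tau>) (inv_step [] y \<rho> \<alpha>)"
abbreviation stepLR where
  "stepLR \<sigma> \<tau> \<pi> f \<rho> \<alpha> \<equiv> Infer (FocLR \<sigma> \<tau>) (inv_step \<pi> f \<rho> \<alpha>)"

text \<open>Derivations whose last rule is an inversion.\<close>

fun inv_headed :: "('d, 'a) derivation \<Rightarrow> bool" where
  "inv_headed (Infer (Inv \<pi> f \<rho>) \<alpha>) = True"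
| "inv_headed \<alpha> = False"

text \<open>\<open>inv_ok \<pi> f \<rho> \<beta> N P\<close> says that \<open>inv_step \<pi> f \<rho> \<beta>\<close> is a well-formed, possibly empty, inversion
  applied to a derivation \<open>\<beta>\<close> of a sequent with non-positive left side \<open>N\<close> and non-negative right
  side \<open>P\<close>, that is, of a sequent that is not itself the conclusion of an inversion.  Every
  derivation splits in this way (\<open>inv_decomp\<close>), and uniquely (\<open>inv_ok_unique\<close>).  When \<open>\<pi>\<close> and \<open>\<rho>\<close>
  are both empty, no label records \<open>f\<close>, but the sequent derived by \<open>\<beta>\<close> does.\<close>

definition inv_ok where
  "inv_ok \<pi> f \<rho> \<beta> N P \<longleftrightarrow> derives p \<beta> (Sequent N (postcomp p (precomp p \<pi> f) \<rho>) P) \<and>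
     nonpositive N \<and> nonnegative P \<and> wf_sequent p (Sequent (pushes \<pi> N) f (pulls \<rho> P))"

lemma inv_ok_not_headed: "inv_ok \<pi> f \<rho> \<beta> N P \<Longrightarrow> \<not> inv_headed \<beta>"
  by (cases \<beta> rule: inv_headed.cases)
    (auto simp: inv_ok_def elim!: derives_InferE elim: inference.cases)

lemma derives_inv_ok:
  "inv_ok \<pi> f \<rho> \<beta> N P \<Longrightarrow> derives p (inv_step \<pi> f \<rho> \<beta>) (Sequent (pushes \<pi> N) f (pulls \<rho> P))"
  by (auto simp: inv_ok_def inv_step_def simp del: wf_sequent.simps
      intro!: derives_Infer infer_Inv dest: derives_wf)

lemma not_headed_neutral:
  "derives p \<alpha> (Sequent S f T) \<Longrightarrow> \<not> inv_headed \<alpha> \<Longrightarrow> nonpositive S \<and> nonnegative T"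
  by (cases \<alpha> rule: inv_headed.cases)
    (auto elim!: derives_InferE derives_AxiomE elim: inference.cases)

lemma inv_okI:
  assumes "\<pi> \<noteq> [] \<or> \<rho> \<noteq> []" "derives p (inv_step \<pi> f \<rho> \<beta>) s"
  shows "\<exists>N P. inv_ok \<pi> f \<rho> \<beta> N P"
proof -
  have "derives p (Infer (Inv \<pi> f \<rho>) \<beta>) s"
    using assms by (simp add: inv_step_def split: if_splits)
  then show ?thesis
    by (auto elim!: derives_InferE inference.cases simp: inv_ok_def simp del: wf_sequent.simps)
qed

lemma inv_decomp:
  assumes "derives p \<alpha> (Sequent S f T)"
  obtains \<pi> \<rho> \<beta> N P where "\<alpha> = inv_step \<pi> f \<rho> \<beta>" "inv_ok \<pi> f \<rho> \<beta> N P"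
    "S = pushes \<pi> N" "T = pulls \<rho> P"
proof (cases "inv_headed \<alpha>")
  case True
  then obtain \<pi> g \<rho> \<beta> where \<alpha>: "\<alpha> = Infer (Inv \<pi> g \<rho>) \<beta>"
    by (cases \<alpha> rule: inv_headed.cases) auto
  with assms obtain t where "derives p \<beta> t" "inference p (Inv \<pi> g \<rho>) t (Sequent S f T)"
    by (auto elim: derives_InferE)
  with \<alpha> that[of \<pi> \<rho> \<beta>] show ?thesis
    by (auto elim!: inference.cases simp: inv_ok_def inv_step_def)
next
  case False
  with assms not_headed_neutral[OF assms] derives_wf[OF assms] that[of "[]" "[]" \<alpha> S T] show ?thesis
    by (simp add: inv_ok_def inv_step_def)
qed

text \<open>The labels \<open>f\<close> and \<open>f'\<close> may differ when the inversion steps are absent; the two steps are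
  nevertheless equal as operations on derivations.\<close>

lemma inv_step_eqD:
  assumes "inv_step \<pi> f \<rho> \<beta> = inv_step \<pi>' f' \<rho>' \<beta>'" "\<not> inv_headed \<beta>" "\<not> inv_headed \<beta>'"
  shows "\<pi> = \<pi>'" "\<rho> = \<rho>'" "\<beta> = \<beta>'" "inv_step \<pi> f \<rho> = inv_step \<pi>' f' \<rho>'"
  using assms by (auto simp: inv_step_def fun_eq_iff split: if_splits)

lemma inv_ok_unique:
  assumes "inv_step \<pi> f \<rho> \<beta> = inv_step \<pi>' f' \<rho>' \<beta>'" 
    and "\<exists>N P. inv_ok \<pi> f \<rho> \<beta> N P" "\<exists>N P. inv_ok \<pi>' f' \<rho>' \<beta>' N P"
  shows "\<pi> = \<pi>' \<and> f = f' \<and> \<rho> = \<rho>' \<and> \<beta> = \<beta>'"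
proof -
  obtain N P N' P' where ok: "inv_ok \<pi> f \<rho> \<beta> N P" "inv_ok \<pi>' f' \<rho>' \<beta>' N' P'"
    using assms(2,3) by blast
  have "Sequent (pushes \<pi> N) f (pulls \<rho> P) = Sequent (pushes \<pi>' N') f' (pulls \<rho>' P')"
    using assms(1) ok derives_inv_ok derives_functional by metis
  with inv_step_eqD[OF assms(1)] ok inv_ok_not_headed show ?thesis
    by blast
qed


section \<open>Typed parallelization\<close>

text \<open>\<open>bifocus \<sigma> \<tau> \<pi> f \<rho> \<beta> s\<close>: the derivation \<open>stepLR \<sigma> \<tau> \<pi> f \<rho> \<beta>\<close> of \<open>s\<close>, presented with its
  canonical inversion step.  This is the data from which both instances of the \<open>par\<close> schemas with
  that right-hand side are built.\<close>

definition bifocus where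
  "bifocus \<sigma> \<tau> \<pi> f \<rho> \<beta> s \<longleftrightarrow>
     (\<exists>N P. inv_ok \<pi> f \<rho> \<beta> N P) \<and> derives p (stepLR \<sigma> \<tau> \<pi> f \<rho> \<beta>) s"

lemma bifocusE:
  assumes "bifocus \<sigma> \<tau> \<pi> f \<rho> \<beta> s"
  obtains N P A B D E F G where "inv_ok \<pi> f \<rho> \<beta> N P" "\<sigma> \<noteq> []" "\<tau> \<noteq> []"
    "\<pi> \<noteq> [] \<or> nonnegative N" "\<rho> \<noteq> [] \<or> nonpositive P" "over p N D" "over p P G"
    "path (target p) A \<sigma> B" "path (target p) D \<pi> B" "f \<in> hom (target p) B E"
    "path (target p) E \<rho> G" "path (target p) E \<tau> F"
    "s = Sequent (pulls \<sigma> (pushes \<pi> N)) (postcomp p (precomp p \<sigma> f) \<tau>) (pushes \<tau> (pulls \<rho> P))"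
proof -
  obtain N P where ok: "inv_ok \<pi> f \<rho> \<beta> N P"
    using assms unfolding bifocus_def by blast
  obtain t where t: "derives p (inv_step \<pi> f \<rho> \<beta>) t" "inference p (FocLR \<sigma> \<tau>) t s"
    using assms unfolding bifocus_def by (blast elim: derives_InferE)
  have "t = Sequent (pushes \<pi> N) f (pulls \<rho> P)"
    using derives_functional[OF t(1) derives_inv_ok[OF ok]] .
  with t(2) have i: "\<sigma> \<noteq> []" "\<tau> \<noteq> []" "\<pi> \<noteq> [] \<or> nonnegative N" "\<rho> \<noteq> [] \<or> nonpositive P"
    "s = Sequent (pulls \<sigma> (pushes \<pi> N)) (postcomp p (precomp p \<sigma> f) \<tau>) (pushes \<tau> (pulls \<rho> P))"
    "wf_sequent p (Sequent (pushes \<pi> N) f (pulls \<rho> P))" "wf_sequent p s"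
    by (auto elim!: inference.cases simp del: wf_sequent.simps)
  from i(6) obtain B E where BE: "over p (pushes \<pi> N) B" "over p (pulls \<rho> P) E"
    "f \<in> hom (target p) B E"
    by auto
  moreover obtain A B' E' F where "over p (pushes \<pi> N) B'" "path (target p) A \<sigma> B'"
    "over p (pulls \<rho> P) E'" "path (target p) E' \<tau> F"
    using i(5,7) by (auto simp: over_pulls[of p \<sigma>] over_pushes[of p \<tau>])
  ultimately have "path (target p) A \<sigma> B" "path (target p) E \<tau> F"
    using over_unique by metis+
  with BE i ok that show ?thesis
    by (auto simp: over_pulls over_pushes)
qed

lemma derives_stepL:
  assumes "inv_ok \<pi> x [] \<beta> N Q" "\<sigma> \<noteq> []" "\<pi> \<noteq> [] \<or> nonnegative N"
    and "over p N D" "over p Q E" "path (target p) A \<sigma> B" "path (target p) D \<pi> B"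
    and "x \<in> hom (target p) B E"
  shows "derives p (stepL \<sigma> \<pi> x \<beta>) (Sequent (pulls \<sigma> (pushes \<pi> N)) (precomp p \<sigma> x) Q)"
proof (rule derives_Infer)
  show d: "derives p (inv_step \<pi> x [] \<beta>) (Sequent (pushes \<pi> N) x Q)"
    using derives_inv_ok[OF assms(1)] by simp
  have "over p (pushes \<pi> N) B"
    using assms by (auto simp: over_pushes)
  with assms have "wf_sequent p (Sequent (pulls \<sigma> (pushes \<pi> N)) (precomp p \<sigma> x) Q)"
    by (auto simp: over_pulls intro: precomp_hom)
  with assms derives_wf[OF d]
  show "inference p (FocL \<sigma>) (Sequent (pushes \<pi> N) x Q)
      (Sequent (pulls \<sigma> (pushes \<pi> N)) (precomp p \<sigma> x) Q)"
    by (auto intro!: infer_FocL[OF _ _ _ refl refl] simp: inv_ok_def simp del: wf_sequent.simps)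
qed

lemma derives_stepR:
  assumes "inv_ok [] y \<rho> \<beta> N P" "\<tau> \<noteq> []" "\<rho> \<noteq> [] \<or> nonpositive P"
    and "over p N B" "over p P G" "path (target p) E \<rho> G" "path (target p) E \<tau> F"
    and "y \<in> hom (target p) B E"
  shows "derives p (stepR \<tau> \<rho> y \<beta>) (Sequent N (postcomp p y \<tau>) (pushes \<tau> (pulls \<rho> P)))"
proof (rule derives_Infer)
  show d: "derives p (inv_step [] y \<rho> \<beta>) (Sequent N y (pulls \<rho> P))"
    using derives_inv_ok[OF assms(1)] by simp
  have "over p (pulls \<rho> P) E"
    using assms by (auto simp: over_pulls)
  with assms have "wf_sequent p (Sequent N (postcomp p y \<tau>) (pushes \<tau> (pulls \<rho> P)))"
    by (auto simp: over_pushes[of p \<tau>] intro: postcomp_hom)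
  with assms derives_wf[OF d]
  show "inference p (FocR \<tau>) (Sequent N y (pulls \<rho> P))
      (Sequent N (postcomp p y \<tau>) (pushes \<tau> (pulls \<rho> P)))"
    by (auto intro!: infer_FocR[OF _ _ _ refl refl] simp: inv_ok_def simp del: wf_sequent.simps)
qed

text \<open>The step \<open>LR\<close> unfolds to \<open>L R\<close>, and symmetrically to \<open>R L\<close>: both are derivations of the same
  sequent, and their inversion steps are again canonical.\<close>

lemma bifocus_sequentialL:
  assumes "bifocus \<sigma> \<tau> \<pi> f \<rho> \<beta> s"
  shows "\<exists>N P. inv_ok [] (precomp p \<pi> f) \<rho> \<beta> N P"
    and "\<exists>N P. inv_ok \<pi> (postcomp p f \<tau>) [] (stepR \<tau> \<rho> (precomp p \<pi> f) \<beta>) N P"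
    and "derives p (stepL \<sigma> \<pi> (postcomp p f \<tau>) (stepR \<tau> \<rho> (precomp p \<pi> f) \<beta>)) s"
proof -
  from assms show "\<exists>N P. inv_ok [] (precomp p \<pi> f) \<rho> \<beta> N P"
    and "\<exists>N P. inv_ok \<pi> (postcomp p f \<tau>) [] (stepR \<tau> \<rho> (precomp p \<pi> f) \<beta>) N P"
    and "derives p (stepL \<sigma> \<pi> (postcomp p f \<tau>) (stepR \<tau> \<rho> (precomp p \<pi> f) \<beta>)) s"
  proof (atomize (full), elim bifocusE, goal_cases)
    case (1 N P A B D E F G)
    let ?Q = "pushes \<tau> (pulls \<rho> P)"
    have Q: "over p ?Q F" "nonnegative ?Q" "over p (pulls \<rho> P) E"
      using 1 by (auto simp: over_pushes over_pulls)
    have pf: "precomp p \<pi> f \<in> hom (target p) D E" and ft: "postcomp p f \<tau> \<in> hom (target p) B F"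
      using 1 by (auto intro: precomp_hom postcomp_hom)
    have R: "inv_ok [] (precomp p \<pi> f) \<rho> \<beta> N P"
      using 1 pf Q by (auto simp: inv_ok_def)
    have "derives p (stepR \<tau> \<rho> (precomp p \<pi> f) \<beta>) (Sequent N (postcomp p (precomp p \<pi> f) \<tau>) ?Q)"
      using derives_stepR[OF R] 1 pf by blast
    then have L: "inv_ok \<pi> (postcomp p f \<tau>) [] (stepR \<tau> \<rho> (precomp p \<pi> f) \<beta>) N ?Q"
      using 1 Q ft postcomp_precomp[of D \<pi> B f E \<tau> F] by (auto simp: inv_ok_def over_pushes[of p \<pi>])
    show ?case
      using R L derives_stepL[OF L _ _ _ Q(1), of \<sigma> D A B] 1 ft postcomp_precomp[of A \<sigma> B f E \<tau> F]
      by auto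
  qed
qed

lemma bifocus_sequentialR:
  assumes "bifocus \<sigma> \<tau> \<pi> f \<rho> \<beta> s"
  shows "\<exists>N P. inv_ok \<pi> (postcomp p f \<rho>) [] \<beta> N P"
    and "\<exists>N P. inv_ok [] (precomp p \<sigma> f) \<rho> (stepL \<sigma> \<pi> (postcomp p f \<rho>) \<beta>) N P"
    and "derives p (stepR \<tau> \<rho> (precomp p \<sigma> f) (stepL \<sigma> \<pi> (postcomp p f \<rho>) \<beta>)) s"
proof -
  from assms show "\<exists>N P. inv_ok \<pi> (postcomp p f \<rho>) [] \<beta> N P"
    and "\<exists>N P. inv_ok [] (precomp p \<sigma> f) \<rho> (stepL \<sigma> \<pi> (postcomp p f \<rho>) \<beta>) N P"
    and "derives p (stepR \<tau> \<rho> (precomp p \<sigma> f) (stepL \<sigma> \<pi> (postcomp p f \<rho>) \<beta>)) s"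
  proof (atomize (full), elim bifocusE, goal_cases)
    case (1 N P A B D E F G)
    let ?M = "pulls \<sigma> (pushes \<pi> N)"
    have M: "over p ?M A" "nonpositive ?M" "over p (pushes \<pi> N) B"
      using 1 by (auto simp: over_pushes over_pulls)
    have sf: "precomp p \<sigma> f \<in> hom (target p) A E" and fr: "postcomp p f \<rho> \<in> hom (target p) B G"
      using 1 by (auto intro: precomp_hom postcomp_hom)
    have L: "inv_ok \<pi> (postcomp p f \<rho>) [] \<beta> N P"
      using 1 fr M postcomp_precomp[of D \<pi> B f E \<rho> G] by (auto simp: inv_ok_def)
    have "derives p (stepL \<sigma> \<pi> (postcomp p f \<rho>) \<beta>) (Sequent ?M (precomp p \<sigma> (postcomp p f \<rho>)) P)"
      using derives_stepL[OF L] 1 fr by blast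
    then have R: "inv_ok [] (precomp p \<sigma> f) \<rho> (stepL \<sigma> \<pi> (postcomp p f \<rho>) \<beta>) ?M P"
      using 1 M sf postcomp_precomp[of A \<sigma> B f E \<rho> G] by (auto simp: inv_ok_def over_pulls[of p \<rho>])
    show ?case
      using L R derives_stepR[OF R _ _ M(1), of \<tau> G E F] 1 sf
      by auto
  qed
qed


text \<open>The two \<open>par\<close> rules at the root, restricted to canonical presentations; on valid derivations
  this is no restriction (\<open>par_rule_complete\<close>).  Here and below, the statements with suffix \<open>_R\<close> are
  the mirror images of those with suffix \<open>_L\<close>.\<close>

definition typed_par_L where
  "typed_par_L \<alpha> \<gamma> \<longleftrightarrow> (\<exists>\<sigma> \<tau> \<pi> f \<rho> \<beta> s. bifocus \<sigma> \<tau> \<pi> f \<rho> \<beta> s \<and> \<gamma> = stepLR \<sigma> \<tau> \<pi> f \<rho> \<beta> \<and>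
     \<alpha> = stepL \<sigma> \<pi> (postcomp p f \<tau>) (stepR \<tau> \<rho> (precomp p \<pi> f) \<beta>))"

definition typed_par_R where
  "typed_par_R \<alpha> \<gamma> \<longleftrightarrow> (\<exists>\<sigma> \<tau> \<pi> f \<rho> \<beta> s. bifocus \<sigma> \<tau> \<pi> f \<rho> \<beta> s \<and> \<gamma> = stepLR \<sigma> \<tau> \<pi> f \<rho> \<beta> \<and>
     \<alpha> = stepR \<tau> \<rho> (precomp p \<sigma> f) (stepL \<sigma> \<pi> (postcomp p f \<rho>) \<beta>))"

text \<open>The two \<open>gra\<close> rules at the root, expressed through \<open>par\<close>: unfold the step \<open>LR\<close> above the
  outermost step so that the latter can be parallelized with the first of the two steps obtained.\<close>

definition typed_gra_L where
  "typed_gra_L \<alpha> \<gamma> \<longleftrightarrow>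
     (\<exists>e b x X Y. typed_par_R X Y \<and> typed_par_L (stepL e b x X) \<gamma> \<and> \<alpha> = stepL e b x Y)"

definition typed_gra_R where
  "typed_gra_R \<alpha> \<gamma> \<longleftrightarrow>
     (\<exists>e d y X Y. typed_par_L X Y \<and> typed_par_R (stepR e d y X) \<gamma> \<and> \<alpha> = stepR e d y Y)"

lemma typed_par_L_derives: "typed_par_L X Y \<Longrightarrow> \<exists>s. derives p X s \<and> derives p Y s"
  unfolding typed_par_L_def using bifocus_sequentialL(3) bifocus_def by blast

lemma typed_par_R_derives: "typed_par_R X Y \<Longrightarrow> \<exists>s. derives p X s \<and> derives p Y s"
  unfolding typed_par_R_def using bifocus_sequentialR(3) bifocus_def by blast

lemma typed_par_L_iff: "typed_par_L X Y \<Longrightarrow> derives p X s \<longleftrightarrow> derives p Y s"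
  using typed_par_L_derives derives_functional by metis

lemma typed_par_R_iff: "typed_par_R X Y \<Longrightarrow> derives p X s \<longleftrightarrow> derives p Y s"
  using typed_par_R_derives derives_functional by metis

lemma typed_par_L_is_par_rule: "typed_par_L X Y \<Longrightarrow> par_rule p X Y"
  unfolding typed_par_L_def bifocus_def inv_ok_def by (auto intro: par_L)

lemma typed_par_R_is_par_rule: "typed_par_R X Y \<Longrightarrow> par_rule p X Y"
  unfolding typed_par_R_def bifocus_def inv_ok_def by (auto intro: par_R)

lemma stepLR_inverse:
  assumes "bifocus \<sigma> \<tau> \<pi> f \<rho> \<beta> s" "bifocus \<sigma>' \<tau>' \<pi>' f' \<rho>' \<beta>' s'"
    and "stepLR \<sigma> \<tau> \<pi> f \<rho> \<beta> = stepLR \<sigma>' \<tau>' \<pi>' f' \<rho>' \<beta>'"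
  shows "\<sigma> = \<sigma>' \<and> \<tau> = \<tau>' \<and> \<pi> = \<pi>' \<and> f = f' \<and> \<rho> = \<rho>' \<and> \<beta> = \<beta>'"
  using assms inv_ok_unique unfolding bifocus_def by blast

lemma typed_par_L_inj: "typed_par_L X Y \<Longrightarrow> typed_par_L X' Y \<Longrightarrow> X = X'"
  unfolding typed_par_L_def using stepLR_inverse by blast

lemma typed_par_R_inj: "typed_par_R X Y \<Longrightarrow> typed_par_R X' Y \<Longrightarrow> X = X'"
  unfolding typed_par_R_def using stepLR_inverse by blast

text \<open>Cancellation in the base category recovers \<open>f\<close> from the two composites recorded in the redex.\<close>

lemma typed_par_L_functional:
  assumes "factorization_preordered (target p)" "typed_par_L X Y" "typed_par_L X Y'"
  shows "Y = Y'"
proof -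
  obtain \<sigma> \<tau> \<pi> f \<rho> \<beta> s where 1: "bifocus \<sigma> \<tau> \<pi> f \<rho> \<beta> s" "Y = stepLR \<sigma> \<tau> \<pi> f \<rho> \<beta>"
    "X = stepL \<sigma> \<pi> (postcomp p f \<tau>) (stepR \<tau> \<rho> (precomp p \<pi> f) \<beta>)"
    using assms(2) unfolding typed_par_L_def by blast
  obtain \<sigma>' \<tau>' \<pi>' f' \<rho>' \<beta>' s' where 2: "bifocus \<sigma>' \<tau>' \<pi>' f' \<rho>' \<beta>' s'"
    "Y' = stepLR \<sigma>' \<tau>' \<pi>' f' \<rho>' \<beta>'"
    "X = stepL \<sigma>' \<pi>' (postcomp p f' \<tau>') (stepR \<tau>' \<rho>' (precomp p \<pi>' f') \<beta>')"
    using assms(3) unfolding typed_par_L_def by blast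
  have 3: "\<sigma> = \<sigma>' \<and>
      inv_step \<pi> (postcomp p f \<tau>) [] (stepR \<tau> \<rho> (precomp p \<pi> f) \<beta>) =
      inv_step \<pi>' (postcomp p f' \<tau>') [] (stepR \<tau>' \<rho>' (precomp p \<pi>' f') \<beta>')"
    using 1(3) 2(3) by simp
  then have outer: "\<sigma> = \<sigma>'" "\<pi> = \<pi>'" "postcomp p f \<tau> = postcomp p f' \<tau>'"
    "stepR \<tau> \<rho> (precomp p \<pi> f) \<beta> = stepR \<tau>' \<rho>' (precomp p \<pi>' f') \<beta>'"
    using inv_ok_unique[OF conjunct2[OF 3] bifocus_sequentialL(2)[OF 1(1)] bifocus_sequentialL(2)[OF 2(1)]]
    by blast+
  from outer(4) have 4: "\<tau> = \<tau>' \<and>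
      inv_step [] (precomp p \<pi> f) \<rho> \<beta> = inv_step [] (precomp p \<pi>' f') \<rho>' \<beta>'"
    by simp
  then have inner: "\<tau> = \<tau>'" "\<rho> = \<rho>'" "\<beta> = \<beta>'" "precomp p \<pi> f = precomp p \<pi>' f'"
    using inv_ok_unique[OF conjunct2[OF 4] bifocus_sequentialL(1)[OF 1(1)] bifocus_sequentialL(1)[OF 2(1)]]
    by blast+
  obtain A B D E F where t: "path (target p) A \<sigma> B" "path (target p) D \<pi> B"
    "f \<in> hom (target p) B E" "path (target p) E \<tau> F" "\<sigma> \<noteq> []" "\<tau> \<noteq> []"
    using bifocusE[OF 1(1)] by metis
  obtain A' B' D' E' F' where t': "path (target p) A' \<sigma> B'" "path (target p) D' \<pi> B'"
    "f' \<in> hom (target p) B' E'" "path (target p) E' \<tau> F'"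
    using bifocusE[OF 2(1)] outer inner by metis
  have "A' = A" "E' = E"
    using t t' path_source_unique by metis+
  with t t' have "B' = B"
    using path_target_unique by metis
  with t' \<open>E' = E\<close> have "f' \<in> hom (target p) B E"
    by simp
  with t outer inner have "f = f'"
    using path_cancel[OF assms(1) t(2,3) _ t(4)] by simp
  with 1 2 outer inner show ?thesis
    by simp
qed

lemma typed_par_R_functional:
  assumes "factorization_preordered (target p)" "typed_par_R X Y" "typed_par_R X Y'"
  shows "Y = Y'"
proof -
  obtain \<sigma> \<tau> \<pi> f \<rho> \<beta> s where 1: "bifocus \<sigma> \<tau> \<pi> f \<rho> \<beta> s" "Y = stepLR \<sigma> \<tau> \<pi> f \<rho> \<beta>"
    "X = stepR \<tau> \<rho> (precomp p \<sigma> f) (stepL \<sigma> \<pi> (postcomp p f \<rho>) \<beta>)"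
    using assms(2) unfolding typed_par_R_def by blast
  obtain \<sigma>' \<tau>' \<pi>' f' \<rho>' \<beta>' s' where 2: "bifocus \<sigma>' \<tau>' \<pi>' f' \<rho>' \<beta>' s'"
    "Y' = stepLR \<sigma>' \<tau>' \<pi>' f' \<rho>' \<beta>'"
    "X = stepR \<tau>' \<rho>' (precomp p \<sigma>' f') (stepL \<sigma>' \<pi>' (postcomp p f' \<rho>') \<beta>')"
    using assms(3) unfolding typed_par_R_def by blast
  have 3: "\<tau> = \<tau>' \<and>
      inv_step [] (precomp p \<sigma> f) \<rho> (stepL \<sigma> \<pi> (postcomp p f \<rho>) \<beta>) =
      inv_step [] (precomp p \<sigma>' f') \<rho>' (stepL \<sigma>' \<pi>' (postcomp p f' \<rho>') \<beta>')"
    using 1(3) 2(3) by simp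
  then have outer: "\<tau> = \<tau>'" "\<rho> = \<rho>'" "precomp p \<sigma> f = precomp p \<sigma>' f'"
    "stepL \<sigma> \<pi> (postcomp p f \<rho>) \<beta> = stepL \<sigma>' \<pi>' (postcomp p f' \<rho>') \<beta>'"
    using inv_ok_unique[OF conjunct2[OF 3] bifocus_sequentialR(2)[OF 1(1)] bifocus_sequentialR(2)[OF 2(1)]]
    by blast+
  from outer(4) have 4: "\<sigma> = \<sigma>' \<and>
      inv_step \<pi> (postcomp p f \<rho>) [] \<beta> = inv_step \<pi>' (postcomp p f' \<rho>') [] \<beta>'"
    by simp
  then have inner: "\<sigma> = \<sigma>'" "\<pi> = \<pi>'" "\<beta> = \<beta>'" "postcomp p f \<rho> = postcomp p f' \<rho>'"
    using inv_ok_unique[OF conjunct2[OF 4] bifocus_sequentialR(1)[OF 1(1)] bifocus_sequentialR(1)[OF 2(1)]]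
    by blast+
  obtain A B E F G where t: "path (target p) A \<sigma> B" "f \<in> hom (target p) B E"
    "path (target p) E \<rho> G" "path (target p) E \<tau> F" "\<sigma> \<noteq> []" "\<tau> \<noteq> []"
    using bifocusE[OF 1(1)] by metis
  obtain A' B' E' F' G' where t': "path (target p) A' \<sigma> B'" "f' \<in> hom (target p) B' E'"
    "path (target p) E' \<rho> G'" "path (target p) E' \<tau> F'"
    using bifocusE[OF 2(1)] outer inner by metis
  have "A' = A" "E' = E"
    using t t' path_source_unique by metis+
  with t t' have "B' = B"
    using path_target_unique by metis
  with t' \<open>E' = E\<close> have "f' \<in> hom (target p) B E"
    by simp
  with t outer inner have "f = f'"
    using path_cancel[OF assms(1) t(1,2) _ t(3)] by simp
  with 1 2 outer inner show ?thesis
    by simp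
qed

lemma bifocus_cong:
  assumes "bifocus \<sigma> \<tau> \<pi> f \<rho> \<beta> s" "\<And>t. derives p \<beta> t \<Longrightarrow> derives p \<beta>' t"
  shows "bifocus \<sigma> \<tau> \<pi> f \<rho> \<beta>' s"
proof -
  have "derives p (stepLR \<sigma> \<tau> \<pi> f \<rho> \<beta>') s"
    using assms derives_Infer_cong derives_inv_step_cong unfolding bifocus_def by metis
  with assms show ?thesis
    unfolding bifocus_def inv_ok_def by blast
qed

text \<open>A redex of \<open>par\<close> does not depend on the derivation \<open>W\<close> above its two steps, apart from the sequent
  that \<open>W\<close> derives.\<close>

lemma typed_par_L_shape:
  assumes "typed_par_L (stepL e b x (stepR \<tau> \<rho> y W)) Z" "\<not> inv_headed W"
  obtains g where "Z = stepLR e \<tau> b g \<rho> W"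
    "\<And>W'. (\<And>t. derives p W t \<Longrightarrow> derives p W' t) \<Longrightarrow>
      typed_par_L (stepL e b x (stepR \<tau> \<rho> y W')) (stepLR e \<tau> b g \<rho> W')"
proof -
  obtain \<sigma> \<tau>' \<pi> f \<rho>' \<beta> s where 1: "bifocus \<sigma> \<tau>' \<pi> f \<rho>' \<beta> s" "Z = stepLR \<sigma> \<tau>' \<pi> f \<rho>' \<beta>"
    "stepL e b x (stepR \<tau> \<rho> y W) =
      stepL \<sigma> \<pi> (postcomp p f \<tau>') (stepR \<tau>' \<rho>' (precomp p \<pi> f) \<beta>)"
    using assms(1) unfolding typed_par_L_def by blast
  then have \<beta>: "\<not> inv_headed \<beta>"
    unfolding bifocus_def using inv_ok_not_headed by blast
  have o: "e = \<sigma>" "b = \<pi>" "stepR \<tau> \<rho> y W = stepR \<tau>' \<rho>' (precomp p \<pi> f) \<beta>"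
    "inv_step b x [] = inv_step \<pi> (postcomp p f \<tau>') []"
    using 1(3) by (auto dest: inv_step_eqD)
  then have i: "\<tau> = \<tau>'" "\<rho> = \<rho>'" "W = \<beta>" "inv_step [] y \<rho> = inv_step [] (precomp p \<pi> f) \<rho>'"
    using inv_step_eqD[OF _ assms(2) \<beta>] by auto
  show thesis
  proof (rule that)
    show "Z = stepLR e \<tau> b f \<rho> W"
      using 1 o i by simp
    show "typed_par_L (stepL e b x (stepR \<tau> \<rho> y W')) (stepLR e \<tau> b f \<rho> W')"
      if "\<And>t. derives p W t \<Longrightarrow> derives p W' t" for W'
    proof -
      have "bifocus e \<tau> b f \<rho> W' s"
        using bifocus_cong[OF 1(1)] that o i by simp
      then show ?thesis
        unfolding typed_par_L_def using o i by metis
    qed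
  qed
qed

lemma typed_par_R_shape:
  assumes "typed_par_R (stepR e d y (stepL \<sigma> \<pi> x W)) Z" "\<not> inv_headed W"
  obtains g where "Z = stepLR \<sigma> e \<pi> g d W"
    "\<And>W'. (\<And>t. derives p W t \<Longrightarrow> derives p W' t) \<Longrightarrow>
      typed_par_R (stepR e d y (stepL \<sigma> \<pi> x W')) (stepLR \<sigma> e \<pi> g d W')"
proof -
  obtain \<sigma>' \<tau> \<pi>' f \<rho> \<beta> s where 1: "bifocus \<sigma>' \<tau> \<pi>' f \<rho> \<beta> s" "Z = stepLR \<sigma>' \<tau> \<pi>' f \<rho> \<beta>"
    "stepR e d y (stepL \<sigma> \<pi> x W) =
      stepR \<tau> \<rho> (precomp p \<sigma>' f) (stepL \<sigma>' \<pi>' (postcomp p f \<rho>) \<beta>)"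
    using assms(1) unfolding typed_par_R_def by blast
  then have \<beta>: "\<not> inv_headed \<beta>"
    unfolding bifocus_def using inv_ok_not_headed by blast
  have o: "e = \<tau>" "d = \<rho>" "stepL \<sigma> \<pi> x W = stepL \<sigma>' \<pi>' (postcomp p f \<rho>) \<beta>"
    "inv_step [] y d = inv_step [] (precomp p \<sigma>' f) \<rho>"
    using 1(3) by (auto dest: inv_step_eqD)
  then have i: "\<sigma> = \<sigma>'" "\<pi> = \<pi>'" "W = \<beta>" "inv_step \<pi> x [] = inv_step \<pi>' (postcomp p f \<rho>) []"
    using inv_step_eqD[OF _ assms(2) \<beta>] by auto
  show thesis
  proof (rule that)
    show "Z = stepLR \<sigma> e \<pi> f d W"
      using 1 o i by simp
    show "typed_par_R (stepR e d y (stepL \<sigma> \<pi> x W')) (stepLR \<sigma> e \<pi> f d W')"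
      if "\<And>t. derives p W t \<Longrightarrow> derives p W' t" for W'
    proof -
      have "bifocus \<sigma> e \<pi> f d W' s"
        using bifocus_cong[OF 1(1)] that o i by simp
      then show ?thesis
        unfolding typed_par_R_def using o i by metis
    qed
  qed
qed


text \<open>A step \<open>LR\<close> in an instance of a rewriting schema need not be canonical: if \<open>\<pi>\<close> and \<open>\<rho>\<close> are empty,
  then \<open>\<beta>\<close> may itself end in an inversion.\<close>

lemma stepLR_normalize:
  assumes "derives p (stepLR \<sigma> \<tau> \<pi> f \<rho> \<beta>) s"
    and "derives p \<beta> (Sequent N (postcomp p (precomp p \<pi> f) \<rho>) P)"
  obtains "bifocus \<sigma> \<tau> \<pi> f \<rho> \<beta> s"
  | \<pi>' \<rho>' \<beta>' N' P' where "\<pi> = []" "\<rho> = []" "\<beta> = inv_step \<pi>' f \<rho>' \<beta>'" "bifocus \<sigma> \<tau> \<pi>' f \<rho>' \<beta>' s"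
      "N = pushes \<pi>' N'" "P = pulls \<rho>' P'"
proof (cases "\<pi> = [] \<and> \<rho> = []")
  case True
  with assms(2) have "derives p \<beta> (Sequent N f P)"
    by simp
  then obtain \<pi>' \<rho>' \<beta>' N' P' where "\<beta> = inv_step \<pi>' f \<rho>' \<beta>'" "inv_ok \<pi>' f \<rho>' \<beta>' N' P'"
    "N = pushes \<pi>' N'" "P = pulls \<rho>' P'"
    by (rule inv_decomp)
  moreover from this have "bifocus \<sigma> \<tau> \<pi>' f \<rho>' \<beta>' s"
    using True assms(1) by (auto simp: bifocus_def inv_step_def split: if_splits)
  ultimately show thesis
    using True that(2) by blast
next
  case False
  with assms(1) inv_okI have "\<exists>N P. inv_ok \<pi> f \<rho> \<beta> N P"
    by (blast elim: derives_InferE)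
  with assms(1) that(1) show thesis
    by (simp add: bifocus_def)
qed

lemma derives_FocLD:
  "derives p (Infer (FocL \<sigma>) \<alpha>) s \<Longrightarrow> derives p \<alpha> (Sequent S f T) \<Longrightarrow> nonnegative S \<and> nonnegative T"
  by (erule derives_InferE, drule (1) derives_functional) (auto elim: inference.cases)

lemma derives_FocRD:
  "derives p (Infer (FocR \<sigma>) \<alpha>) s \<Longrightarrow> derives p \<alpha> (Sequent S f T) \<Longrightarrow> nonpositive S \<and> nonpositive T"
  by (erule derives_InferE, drule (1) derives_functional) (auto elim: inference.cases)

lemma par_rule_complete:
  assumes "par_rule p \<alpha> \<gamma>" "derives p \<alpha> s" "derives p \<gamma> s"
  shows "typed_par_L \<alpha> \<gamma> \<or> typed_par_R \<alpha> \<gamma>"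
  using assms(1)
proof cases
  case (par_L \<beta> N \<pi> f \<rho> P \<sigma> \<tau>)
  from assms(3)[unfolded par_L(2)] show ?thesis
  proof (rule stepLR_normalize[OF _ par_L(3)], goal_cases)
    case 1
    with par_L show ?thesis
      unfolding typed_par_L_def by blast
  next
    case (2 \<pi>' \<rho>' \<beta>' N' P')
    have "derives p (Infer (FocL \<sigma>) (Infer (FocR \<tau>) \<beta>)) s"
      using assms(2) par_L 2 by simp
    then obtain t where "derives p (Infer (FocR \<tau>) \<beta>) t"
      by (blast elim: derives_InferE)
    \<comment> \<open>\<open>FocR\<close> requires a non-positive left side in its premise, so \<open>\<beta>\<close> ends at most in a right inversion.\<close>
    then have "\<pi>' = []"
      using derives_FocRD[OF _ par_L(3)] 2 by simp
    with 2 par_L have "bifocus \<sigma> \<tau> [] f \<rho>' \<beta>' s" "\<gamma> = stepLR \<sigma> \<tau> [] f \<rho>' \<beta>'"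
      "\<alpha> = stepL \<sigma> [] (postcomp p f \<tau>) (stepR \<tau> \<rho>' (precomp p [] f) \<beta>')"
      by simp_all
    then show ?thesis
      unfolding typed_par_L_def by blast
  qed
next
  case (par_R \<beta> N \<pi> f \<rho> P \<tau> \<sigma>)
  from assms(3)[unfolded par_R(2)] show ?thesis
  proof (rule stepLR_normalize[OF _ par_R(3)], goal_cases)
    case 1
    with par_R show ?thesis
      unfolding typed_par_R_def by blast
  next
    case (2 \<pi>' \<rho>' \<beta>' N' P')
    have "derives p (Infer (FocR \<tau>) (Infer (FocL \<sigma>) \<beta>)) s"
      using assms(2) par_R 2 by simp
    then obtain t where "derives p (Infer (FocL \<sigma>) \<beta>) t"
      by (blast elim: derives_InferE)
    then have "\<rho>' = []"
      using derives_FocLD[OF _ par_R(3)] 2 by simp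
    with 2 par_R have "bifocus \<sigma> \<tau> \<pi>' f [] \<beta>' s" "\<gamma> = stepLR \<sigma> \<tau> \<pi>' f [] \<beta>'"
      "\<alpha> = stepR \<tau> [] (precomp p \<sigma> f) (stepL \<sigma> \<pi>' (postcomp p f []) \<beta>')"
      by simp_all
    then show ?thesis
      unfolding typed_par_R_def by blast
  qed
qed

text \<open>The condition \<open>b f = b' g\<close> of the \<open>gra\<close> schema is what makes the unfolded step \<open>R\<close>, whose arrow
  is \<open>b f\<close>, fit a redex of \<open>par\<close> with contractum arrow \<open>g\<close>.\<close>

lemma gra_L_complete:
  assumes \<alpha>: "derives p (stepL e b' (postcomp p g d) (stepLR b d a f c \<beta>)) s"
    and \<gamma>: "derives p (stepLR e d b' g c (stepL b a (postcomp p f c) \<beta>)) s"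
    and \<beta>: "derives p \<beta> (Sequent N (postcomp p (precomp p a f) c) P)"
    and eq: "precomp p b f = precomp p b' g"
  shows "typed_gra_L (stepL e b' (postcomp p g d) (stepLR b d a f c \<beta>))
    (stepLR e d b' g c (stepL b a (postcomp p f c) \<beta>))"
proof -
  let ?Y = "stepLR b d a f c \<beta>" and ?W = "stepL b a (postcomp p f c) \<beta>"
  let ?X = "stepR d c (precomp p b f) ?W"
  obtain t u where Y: "derives p ?Y t" and W: "derives p ?W u"
    using \<alpha> \<gamma> by (metis (no_types) derives_InferE inv_step_def)
  have X: "typed_par_R ?X ?Y"
    using Y \<beta>
  proof (rule stepLR_normalize, goal_cases)
    case 1
    then show ?case
      unfolding typed_par_R_def by blast
  next
    case (2 a1 c1 \<beta>1 N1 P1)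
    with W have "derives p (Infer (FocL b) \<beta>) u"
      by simp
    with derives_FocLD[OF _ \<beta>] 2 have "c1 = []"
      by simp
    with 2 have "bifocus b d a1 f [] \<beta>1 t" "?Y = stepLR b d a1 f [] \<beta>1"
      "?X = stepR d [] (precomp p b f) (stepL b a1 (postcomp p f []) \<beta>1)"
      by simp_all
    then show ?case
      unfolding typed_par_R_def by blast
  qed
  \<comment> \<open>The conclusion of \<open>LR\<close> has a negative left side, which \<open>FocL\<close> does not accept in its premise.\<close>
  have "b' \<noteq> []"
  proof
    assume "b' = []"
    with \<alpha> have "derives p (Infer (FocL e) ?Y) s"
      by simp
    moreover obtain S h T where "t = Sequent S h T" "\<not> nonnegative S"
      using Y by (auto elim!: derives_InferE elim: inference.cases)
    ultimately show False
      using Y derives_FocLD by blast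
  qed
  with \<gamma> inv_okI have "bifocus e d b' g c ?W s"
    unfolding bifocus_def by (blast elim: derives_InferE)
  then have "typed_par_L (stepL e b' (postcomp p g d) ?X) (stepLR e d b' g c ?W)"
    unfolding typed_par_L_def eq by blast
  with X show ?thesis
    unfolding typed_gra_L_def by blast
qed

lemma gra_R_complete:
  assumes \<alpha>: "derives p (stepR e d' (precomp p b g) (stepLR b d a f c \<beta>)) s"
    and \<gamma>: "derives p (stepLR b e a g d' (stepR d c (precomp p a f) \<beta>)) s"
    and \<beta>: "derives p \<beta> (Sequent N (postcomp p (precomp p a f) c) P)"
    and eq: "postcomp p f d = postcomp p g d'"
  shows "typed_gra_R (stepR e d' (precomp p b g) (stepLR b d a f c \<beta>))
    (stepLR b e a g d' (stepR d c (precomp p a f) \<beta>))"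
proof -
  let ?Y = "stepLR b d a f c \<beta>" and ?W = "stepR d c (precomp p a f) \<beta>"
  let ?X = "stepL b a (postcomp p f d) ?W"
  obtain t u where Y: "derives p ?Y t" and W: "derives p ?W u"
    using \<alpha> \<gamma> by (metis (no_types) derives_InferE inv_step_def)
  have X: "typed_par_L ?X ?Y"
    using Y \<beta>
  proof (rule stepLR_normalize, goal_cases)
    case 1
    then show ?case
      unfolding typed_par_L_def by blast
  next
    case (2 a1 c1 \<beta>1 N1 P1)
    with W have "derives p (Infer (FocR d) \<beta>) u"
      by simp
    with derives_FocRD[OF _ \<beta>] 2 have "a1 = []"
      by simp
    with 2 have "bifocus b d [] f c1 \<beta>1 t" "?Y = stepLR b d [] f c1 \<beta>1"
      "?X = stepL b [] (postcomp p f d) (stepR d c1 (precomp p [] f) \<beta>1)"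
      by simp_all
    then show ?case
      unfolding typed_par_L_def by blast
  qed
  have "d' \<noteq> []"
  proof
    assume "d' = []"
    with \<alpha> have "derives p (Infer (FocR e) ?Y) s"
      by simp
    moreover obtain S h T where "t = Sequent S h T" "\<not> nonpositive T"
      using Y by (auto elim!: derives_InferE elim: inference.cases)
    ultimately show False
      using Y derives_FocRD by blast
  qed
  with \<gamma> inv_okI have "bifocus b e a g d' ?W s"
    unfolding bifocus_def by (blast elim: derives_InferE)
  then have "typed_par_R (stepR e d' (precomp p b g) ?X) (stepLR b e a g d' ?W)"
    unfolding typed_par_R_def eq by blast
  with X show ?thesis
    unfolding typed_gra_R_def by blast
qed

lemma typed_gra_L_sound:
  assumes "typed_gra_L \<alpha> \<gamma>"
  shows "gra_rule p \<alpha> \<gamma> \<and> (\<exists>s. derives p \<alpha> s \<and> derives p \<gamma> s)"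
proof -
  obtain e b x X Y where XY: "typed_par_R X Y" "typed_par_L (stepL e b x X) \<gamma>" "\<alpha> = stepL e b x Y"
    using assms unfolding typed_gra_L_def by blast
  obtain \<sigma> \<tau> \<pi> f \<rho> \<beta> s where 1: "bifocus \<sigma> \<tau> \<pi> f \<rho> \<beta> s" "Y = stepLR \<sigma> \<tau> \<pi> f \<rho> \<beta>"
    "X = stepR \<tau> \<rho> (precomp p \<sigma> f) (stepL \<sigma> \<pi> (postcomp p f \<rho>) \<beta>)"
    using XY(1) unfolding typed_par_R_def by blast
  obtain e' \<tau>' b' g \<rho>' \<beta>' s' where 2: "bifocus e' \<tau>' b' g \<rho>' \<beta>' s'" "\<gamma> = stepLR e' \<tau>' b' g \<rho>' \<beta>'"
    "stepL e b x X = stepL e' b' (postcomp p g \<tau>') (stepR \<tau>' \<rho>' (precomp p b' g) \<beta>')"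
    using XY(2) unfolding typed_par_L_def by blast
  have o: "e = e'" "b = b'" "X = stepR \<tau>' \<rho>' (precomp p b' g) \<beta>'"
    "inv_step b x [] = inv_step b' (postcomp p g \<tau>') []"
    using 2(3) 1(3) by (auto dest: inv_step_eqD)
  from o(3) 1(3) have i: "\<tau> = \<tau>' \<and> inv_step [] (precomp p \<sigma> f) \<rho> (stepL \<sigma> \<pi> (postcomp p f \<rho>) \<beta>)
      = inv_step [] (precomp p b' g) \<rho>' \<beta>'"
    by simp
  then have i': "precomp p \<sigma> f = precomp p b' g" "\<rho> = \<rho>'" "\<beta>' = stepL \<sigma> \<pi> (postcomp p f \<rho>) \<beta>"
    using inv_ok_unique[OF conjunct2[OF i] bifocus_sequentialR(2)[OF 1(1)]
        bifocus_sequentialL(1)[OF 2(1)]]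
    by blast+
  obtain N P where \<beta>: "derives p \<beta> (Sequent N (postcomp p (precomp p \<pi> f) \<rho>) P)"
    using 1(1) unfolding bifocus_def inv_ok_def by blast
  have \<alpha>: "\<alpha> = stepL e b (postcomp p g \<tau>) (stepLR \<sigma> \<tau> \<pi> f \<rho> \<beta>)"
    using XY(3) 1(2) o(1,2) i fun_cong[OF o(4)] by simp
  have \<gamma>: "\<gamma> = stepLR e \<tau> b g \<rho> (stepL \<sigma> \<pi> (postcomp p f \<rho>) \<beta>)"
    using 2(2) o i i' by simp
  have eq: "precomp p \<sigma> f = precomp p b g"
    using i'(1) o(2) by simp
  have "gra_rule p \<alpha> \<gamma>"
    unfolding \<alpha> \<gamma> by (rule gra_L[OF \<beta> eq])
  moreover obtain s where "derives p (stepL e b x X) s" "derives p \<gamma> s"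
    using typed_par_L_derives[OF XY(2)] by blast
  moreover from this have "derives p \<alpha> s"
    using typed_par_R_iff[OF XY(1)] XY(3) derives_Infer_cong derives_inv_step_cong by metis
  ultimately show ?thesis
    by blast
qed

lemma typed_gra_R_sound:
  assumes "typed_gra_R \<alpha> \<gamma>"
  shows "gra_rule p \<alpha> \<gamma> \<and> (\<exists>s. derives p \<alpha> s \<and> derives p \<gamma> s)"
proof -
  obtain e d y X Y where XY: "typed_par_L X Y" "typed_par_R (stepR e d y X) \<gamma>" "\<alpha> = stepR e d y Y"
    using assms unfolding typed_gra_R_def by blast
  obtain \<sigma> \<tau> \<pi> f \<rho> \<beta> s where 1: "bifocus \<sigma> \<tau> \<pi> f \<rho> \<beta> s" "Y = stepLR \<sigma> \<tau> \<pi> f \<rho> \<beta>"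
    "X = stepL \<sigma> \<pi> (postcomp p f \<tau>) (stepR \<tau> \<rho> (precomp p \<pi> f) \<beta>)"
    using XY(1) unfolding typed_par_L_def by blast
  obtain \<sigma>' e' \<pi>' g d' \<beta>' s' where 2: "bifocus \<sigma>' e' \<pi>' g d' \<beta>' s'" "\<gamma> = stepLR \<sigma>' e' \<pi>' g d' \<beta>'"
    "stepR e d y X = stepR e' d' (precomp p \<sigma>' g) (stepL \<sigma>' \<pi>' (postcomp p g d') \<beta>')"
    using XY(2) unfolding typed_par_R_def by blast
  have o: "e = e'" "d = d'" "X = stepL \<sigma>' \<pi>' (postcomp p g d') \<beta>'"
    "inv_step [] y d = inv_step [] (precomp p \<sigma>' g) d'"
    using 2(3) 1(3) by (auto dest: inv_step_eqD)
  from o(3) 1(3) have i: "\<sigma> = \<sigma>' \<and> inv_step \<pi> (postcomp p f \<tau>) [] (stepR \<tau> \<rho> (precomp p \<pi> f) \<beta>)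
      = inv_step \<pi>' (postcomp p g d') [] \<beta>'"
    by simp
  then have i': "postcomp p f \<tau> = postcomp p g d'" "\<pi> = \<pi>'" "\<beta>' = stepR \<tau> \<rho> (precomp p \<pi> f) \<beta>"
    using inv_ok_unique[OF conjunct2[OF i] bifocus_sequentialL(2)[OF 1(1)]
        bifocus_sequentialR(1)[OF 2(1)]]
    by blast+
  obtain N P where \<beta>: "derives p \<beta> (Sequent N (postcomp p (precomp p \<pi> f) \<rho>) P)"
    using 1(1) unfolding bifocus_def inv_ok_def by blast
  have \<alpha>: "\<alpha> = stepR e d (precomp p \<sigma> g) (stepLR \<sigma> \<tau> \<pi> f \<rho> \<beta>)"
    using XY(3) 1(2) o(1,2) i fun_cong[OF o(4)] by simp
  have \<gamma>: "\<gamma> = stepLR \<sigma> e \<pi> g d (stepR \<tau> \<rho> (precomp p \<pi> f) \<beta>)"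
    using 2(2) o i i' by simp
  have eq: "postcomp p f \<tau> = postcomp p g d"
    using i'(1) o(2) by simp
  have "gra_rule p \<alpha> \<gamma>"
    unfolding \<alpha> \<gamma> by (rule gra_R[OF \<beta> eq])
  moreover obtain s where "derives p (stepR e d y X) s" "derives p \<gamma> s"
    using typed_par_R_derives[OF XY(2)] by blast
  moreover from this have "derives p \<alpha> s"
    using typed_par_L_iff[OF XY(1)] XY(3) derives_Infer_cong derives_inv_step_cong by metis
  ultimately show ?thesis
    by blast
qed

text \<open>A rewriting step at the root between valid derivations (\<open>root_step_iff\<close>).\<close>

definition root_step where
  "root_step \<alpha> \<gamma> \<longleftrightarrow> typed_par_L \<alpha> \<gamma> \<or> typed_par_R \<alpha> \<gamma> \<or> typed_gra_L \<alpha> \<gamma> \<or> typed_gra_R \<alpha> \<gamma>"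

lemma root_step_iff:
  "(\<exists>s. (par_rule p \<alpha> \<gamma> \<or> gra_rule p \<alpha> \<gamma>) \<and> derives p \<alpha> s \<and> derives p \<gamma> s) \<longleftrightarrow> root_step \<alpha> \<gamma>"
proof
  assume "\<exists>s. (par_rule p \<alpha> \<gamma> \<or> gra_rule p \<alpha> \<gamma>) \<and> derives p \<alpha> s \<and> derives p \<gamma> s"
  then obtain s where s: "par_rule p \<alpha> \<gamma> \<or> gra_rule p \<alpha> \<gamma>" "derives p \<alpha> s" "derives p \<gamma> s"
    by blast
  from s(1) show "root_step \<alpha> \<gamma>"
  proof
    assume "gra_rule p \<alpha> \<gamma>"
    then show ?thesis
      using s(2,3) gra_L_complete gra_R_complete unfolding root_step_def by cases (simp; blast)+
  qed (use s par_rule_complete root_step_def in blast)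
qed (use root_step_def typed_par_L_derives typed_par_R_derives typed_par_L_is_par_rule
    typed_par_R_is_par_rule typed_gra_L_sound typed_gra_R_sound in metis)

lemma rewrite_cases:
  assumes "rewrite_step p \<alpha> \<gamma>"
  obtains "root_step \<alpha> \<gamma>"
  | r \<alpha>' \<gamma>' where "\<alpha> = Infer r \<alpha>'" "\<gamma> = Infer r \<gamma>'" "rewrite_step p \<alpha>' \<gamma>'"
  using assms by cases (use root_step_iff in blast)+

lemma root_step_rewrite: "root_step \<alpha> \<gamma> \<Longrightarrow> rewrite_step p \<alpha> \<gamma>"
  using root_step_iff rewrite_root by blast


section \<open>Local confluence and termination\<close>

lemma rewrite_derives: "rewrite_step p \<alpha> \<beta> \<Longrightarrow> derives p \<alpha> s \<Longrightarrow> derives p \<beta> s"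
proof (induction arbitrary: s rule: rewrite_step.induct)
  case (rewrite_root \<alpha> \<beta> t)
  then show ?case using derives_functional by metis
next
  case (rewrite_Infer \<alpha> \<beta> r)
  then show ?case using derives_Infer_cong by blast
qed

lemma rewrite_inv_stepI:
  "rewrite_step p \<alpha> \<beta> \<Longrightarrow> rewrite_step p (inv_step \<pi> f \<rho> \<alpha>) (inv_step \<pi> f \<rho> \<beta>)"
  by (simp add: inv_step_def rewrite_Infer)

lemma typed_par_L_head: "typed_par_L \<alpha> \<gamma> \<Longrightarrow> \<exists>\<sigma> \<delta>. \<alpha> = Infer (FocL \<sigma>) \<delta>"
  and typed_par_R_head: "typed_par_R \<alpha> \<gamma> \<Longrightarrow> \<exists>\<sigma> \<delta>. \<alpha> = Infer (FocR \<sigma>) \<delta>"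
  and typed_gra_L_head: "typed_gra_L \<alpha> \<gamma> \<Longrightarrow> \<exists>\<sigma> \<delta>. \<alpha> = Infer (FocL \<sigma>) \<delta>"
  and typed_gra_R_head: "typed_gra_R \<alpha> \<gamma> \<Longrightarrow> \<exists>\<sigma> \<delta>. \<alpha> = Infer (FocR \<sigma>) \<delta>"
  by (auto simp: typed_par_L_def typed_par_R_def typed_gra_L_def typed_gra_R_def)

lemma rewrite_inv_stepE:
  assumes "rewrite_step p (inv_step \<pi> f \<rho> \<alpha>) \<gamma>"
  obtains \<beta> where "\<gamma> = inv_step \<pi> f \<rho> \<beta>" "rewrite_step p \<alpha> \<beta>"
proof (cases "\<pi> = [] \<and> \<rho> = []")
  case False
  with assms have "rewrite_step p (Infer (Inv \<pi> f \<rho>) \<alpha>) \<gamma>"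
    by (simp add: inv_step_def split: if_splits)
  then show thesis
  proof (rule rewrite_cases)
    assume "root_step (Infer (Inv \<pi> f \<rho>) \<alpha>) \<gamma>"
    then show thesis
      unfolding root_step_def using typed_par_L_head typed_par_R_head typed_gra_L_head typed_gra_R_head by blast
  qed (use False that in \<open>auto simp: inv_step_def\<close>)
qed (use assms that in auto)

lemma rewrite_stepLRE:
  assumes "rewrite_step p (stepLR \<sigma> \<tau> \<pi> f \<rho> \<alpha>) \<gamma>"
  obtains \<beta> where "\<gamma> = stepLR \<sigma> \<tau> \<pi> f \<rho> \<beta>" "rewrite_step p \<alpha> \<beta>"
  using assms
proof (rule rewrite_cases)
  assume "root_step (stepLR \<sigma> \<tau> \<pi> f \<rho> \<alpha>) \<gamma>"
  then show thesis
    unfolding root_step_def using typed_par_L_head typed_par_R_head typed_gra_L_head typed_gra_R_head by blast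
qed (auto elim!: rewrite_inv_stepE intro: that)

text \<open>A redex of \<open>par\<close> at the root against any step strictly inside it.\<close>

lemma typed_par_L_peak:
  assumes "typed_par_L (Infer r \<alpha>) Z" "rewrite_step p \<alpha> \<gamma>"
  shows "\<exists>\<delta>. (rewrite_step p)\<^sup>*\<^sup>* Z \<delta> \<and> (rewrite_step p)\<^sup>*\<^sup>* (Infer r \<gamma>) \<delta>"
proof -
  obtain \<sigma> \<tau> \<pi> f \<rho> W s x y where 1: "bifocus \<sigma> \<tau> \<pi> f \<rho> W s"
    "Infer r \<alpha> = stepL \<sigma> \<pi> x (stepR \<tau> \<rho> y W)"
    using assms(1) unfolding typed_par_L_def by blast
  let ?X = "stepR \<tau> \<rho> y W"
  have W: "\<not> inv_headed W"
    using 1(1) inv_ok_not_headed unfolding bifocus_def by blast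
  have typed_par_L: "typed_par_L (stepL \<sigma> \<pi> x ?X) Z"
    using assms(1) 1(2) by simp
  obtain g where Z: "Z = stepLR \<sigma> \<tau> \<pi> g \<rho> W" and
    replace: "\<And>W'. (\<And>t. derives p W t \<Longrightarrow> derives p W' t) \<Longrightarrow>
      typed_par_L (stepL \<sigma> \<pi> x (stepR \<tau> \<rho> y W')) (stepLR \<sigma> \<tau> \<pi> g \<rho> W')"
    using typed_par_L_shape[OF typed_par_L W] by metis
  obtain X' where X': "Infer r \<gamma> = stepL \<sigma> \<pi> x X'" "rewrite_step p ?X X'"
    using assms(2) 1(2) by (auto elim: rewrite_inv_stepE)
  from X'(2) show ?thesis
  proof (rule rewrite_cases)
    assume "root_step ?X X'"
    then consider "typed_par_R ?X X'" | "typed_gra_R ?X X'"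
      unfolding root_step_def using typed_par_L_head typed_gra_L_head by blast
    then show ?thesis
    proof cases
      case 1
      \<comment> \<open>Overlap \<open>L R L\<close>: a \<open>gra\<close> step leads from the contractum of the inner redex to that of
        the outer one.\<close>
      with typed_par_L have "typed_gra_L (stepL \<sigma> \<pi> x X') Z"
        unfolding typed_gra_L_def by blast
      then show ?thesis
        using X'(1) root_step_rewrite unfolding root_step_def by auto
    next
      case 2
      \<comment> \<open>Overlap \<open>L R LR\<close>: here \<open>V'\<close> is the step \<open>LR\<close> and \<open>V\<close> its unfolding, so that with \<open>V\<close> in place
        of \<open>V'\<close> the previous overlap applies; folding \<open>V\<close> back is an inner step.\<close>
      then obtain e d z V V' where V: "typed_par_L V V'" "typed_par_R (stepR e d z V) X'" "?X = stepR e d z V'"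
        unfolding typed_gra_R_def by blast
      have "\<not> inv_headed V'"
        using V(1) by (auto simp: typed_par_L_def)
      with V(3) W have eq: "\<tau> = e" "\<rho> = d" "W = V'" "inv_step [] y \<rho> = inv_step [] z d"
        by (auto dest: inv_step_eqD)
      let ?Z = "stepLR \<sigma> \<tau> \<pi> g \<rho> V"
      have "typed_par_L (stepL \<sigma> \<pi> x (stepR \<tau> \<rho> y V)) ?Z"
        using replace typed_par_L_iff[OF V(1)] eq(3) by blast
      moreover have "typed_par_R (stepR \<tau> \<rho> y V) X'"
        using V(2) eq by metis
      ultimately have "rewrite_step p (stepL \<sigma> \<pi> x X') ?Z"
        using root_step_rewrite unfolding root_step_def typed_gra_L_def by blast
      moreover have "rewrite_step p ?Z Z"
        using V(1) eq(3) Z root_step_rewrite unfolding root_step_def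
        by (auto intro!: rewrite_Infer rewrite_inv_stepI)
      ultimately show ?thesis
        using X'(1) by auto
    qed
  next
    fix r' \<alpha>' \<gamma>'
    assume "?X = Infer r' \<alpha>'" "X' = Infer r' \<gamma>'" "rewrite_step p \<alpha>' \<gamma>'"
    then obtain W' where W': "X' = stepR \<tau> \<rho> y W'" "rewrite_step p W W'"
      by (auto elim: rewrite_inv_stepE)
    have "rewrite_step p (stepL \<sigma> \<pi> x X') (stepLR \<sigma> \<tau> \<pi> g \<rho> W')"
      using replace[of W'] rewrite_derives[OF W'(2)] W'(1) root_step_rewrite unfolding root_step_def by blast
    moreover have "rewrite_step p Z (stepLR \<sigma> \<tau> \<pi> g \<rho> W')"
      unfolding Z using W'(2) by (intro rewrite_Infer rewrite_inv_stepI)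
    ultimately show ?thesis
      using X'(1) by auto
  qed
qed

lemma typed_par_R_peak:
  assumes "typed_par_R (Infer r \<alpha>) Z" "rewrite_step p \<alpha> \<gamma>"
  shows "\<exists>\<delta>. (rewrite_step p)\<^sup>*\<^sup>* Z \<delta> \<and> (rewrite_step p)\<^sup>*\<^sup>* (Infer r \<gamma>) \<delta>"
proof -
  obtain \<sigma> \<tau> \<pi> f \<rho> W s x y where 1: "bifocus \<sigma> \<tau> \<pi> f \<rho> W s"
    "Infer r \<alpha> = stepR \<tau> \<rho> y (stepL \<sigma> \<pi> x W)"
    using assms(1) unfolding typed_par_R_def by blast
  let ?X = "stepL \<sigma> \<pi> x W"
  have W: "\<not> inv_headed W"
    using 1(1) inv_ok_not_headed unfolding bifocus_def by blast
  have typed_par_R: "typed_par_R (stepR \<tau> \<rho> y ?X) Z"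
    using assms(1) 1(2) by simp
  obtain g where Z: "Z = stepLR \<sigma> \<tau> \<pi> g \<rho> W" and
    replace: "\<And>W'. (\<And>t. derives p W t \<Longrightarrow> derives p W' t) \<Longrightarrow>
      typed_par_R (stepR \<tau> \<rho> y (stepL \<sigma> \<pi> x W')) (stepLR \<sigma> \<tau> \<pi> g \<rho> W')"
    using typed_par_R_shape[OF typed_par_R W] by metis
  obtain X' where X': "Infer r \<gamma> = stepR \<tau> \<rho> y X'" "rewrite_step p ?X X'"
    using assms(2) 1(2) by (auto elim: rewrite_inv_stepE)
  from X'(2) show ?thesis
  proof (rule rewrite_cases)
    assume "root_step ?X X'"
    then consider "typed_par_L ?X X'" | "typed_gra_L ?X X'"
      unfolding root_step_def using typed_par_R_head typed_gra_R_head by blast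
    then show ?thesis
    proof cases
      case 1
      \<comment> \<open>Overlap \<open>R L R\<close>: a \<open>gra\<close> step leads from the contractum of the inner redex to that of
        the outer one.\<close>
      with typed_par_R have "typed_gra_R (stepR \<tau> \<rho> y X') Z"
        unfolding typed_gra_R_def by blast
      then show ?thesis
        using X'(1) root_step_rewrite unfolding root_step_def by auto
    next
      case 2
      \<comment> \<open>Overlap \<open>R L LR\<close>: here \<open>V'\<close> is the step \<open>LR\<close> and \<open>V\<close> its unfolding, so that with \<open>V\<close> in place
        of \<open>V'\<close> the previous overlap applies; folding \<open>V\<close> back is an inner step.\<close>
      then obtain e b z V V' where V: "typed_par_R V V'" "typed_par_L (stepL e b z V) X'" "?X = stepL e b z V'"
        unfolding typed_gra_L_def by blast
      have "\<not> inv_headed V'"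
        using V(1) by (auto simp: typed_par_R_def)
      with V(3) W have eq: "\<sigma> = e" "\<pi> = b" "W = V'" "inv_step \<pi> x [] = inv_step b z []"
        by (auto dest: inv_step_eqD)
      let ?Z = "stepLR \<sigma> \<tau> \<pi> g \<rho> V"
      have "typed_par_R (stepR \<tau> \<rho> y (stepL \<sigma> \<pi> x V)) ?Z"
        using replace typed_par_R_iff[OF V(1)] eq(3) by blast
      moreover have "typed_par_L (stepL \<sigma> \<pi> x V) X'"
        using V(2) eq by metis
      ultimately have "rewrite_step p (stepR \<tau> \<rho> y X') ?Z"
        using root_step_rewrite unfolding root_step_def typed_gra_R_def by blast
      moreover have "rewrite_step p ?Z Z"
        using V(1) eq(3) Z root_step_rewrite unfolding root_step_def
        by (auto intro!: rewrite_Infer rewrite_inv_stepI)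
      ultimately show ?thesis
        using X'(1) by auto
    qed
  next
    fix r' \<alpha>' \<gamma>'
    assume "?X = Infer r' \<alpha>'" "X' = Infer r' \<gamma>'" "rewrite_step p \<alpha>' \<gamma>'"
    then obtain W' where W': "X' = stepL \<sigma> \<pi> x W'" "rewrite_step p W W'"
      by (auto elim: rewrite_inv_stepE)
    have "rewrite_step p (stepR \<tau> \<rho> y X') (stepLR \<sigma> \<tau> \<pi> g \<rho> W')"
      using replace[of W'] rewrite_derives[OF W'(2)] W'(1) root_step_rewrite unfolding root_step_def by blast
    moreover have "rewrite_step p Z (stepLR \<sigma> \<tau> \<pi> g \<rho> W')"
      unfolding Z using W'(2) by (intro rewrite_Infer rewrite_inv_stepI)
    ultimately show ?thesis
      using X'(1) by auto
  qed
qed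

lemma typed_gra_L_peak:
  assumes "typed_gra_L (Infer r \<alpha>) Z" "rewrite_step p \<alpha> \<gamma>"
  shows "\<exists>\<delta>. (rewrite_step p)\<^sup>*\<^sup>* Z \<delta> \<and> (rewrite_step p)\<^sup>*\<^sup>* (Infer r \<gamma>) \<delta>"
proof -
  obtain e b x X Y where XY: "typed_par_R X Y" "typed_par_L (stepL e b x X) Z" "Infer r \<alpha> = stepL e b x Y"
    using assms(1) unfolding typed_gra_L_def by blast
  obtain \<sigma> \<tau> \<pi> f \<rho> \<beta> s where 1: "bifocus \<sigma> \<tau> \<pi> f \<rho> \<beta> s" "Y = stepLR \<sigma> \<tau> \<pi> f \<rho> \<beta>"
    "X = stepR \<tau> \<rho> (precomp p \<sigma> f) (stepL \<sigma> \<pi> (postcomp p f \<rho>) \<beta>)"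
    using XY(1) unfolding typed_par_R_def by blast
  obtain \<beta>' where \<beta>': "Infer r \<gamma> = stepL e b x (stepLR \<sigma> \<tau> \<pi> f \<rho> \<beta>')" "rewrite_step p \<beta> \<beta>'"
    using assms(2) XY(3) 1(2) by (auto elim!: rewrite_inv_stepE rewrite_stepLRE)
  let ?W = "stepL \<sigma> \<pi> (postcomp p f \<rho>)"
  obtain g where Z: "Z = stepLR e \<tau> b g \<rho> (?W \<beta>)" and
    replace: "\<And>W'. (\<And>t. derives p (?W \<beta>) t \<Longrightarrow> derives p W' t) \<Longrightarrow>
      typed_par_L (stepL e b x (stepR \<tau> \<rho> (precomp p \<sigma> f) W')) (stepLR e \<tau> b g \<rho> W')"
    using typed_par_L_shape[OF XY(2)[unfolded 1(3)]] by (metis inv_headed.simps(3))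
  have W: "rewrite_step p (?W \<beta>) (?W \<beta>')"
    using \<beta>'(2) by (intro rewrite_Infer rewrite_inv_stepI)
  have "typed_par_L (stepL e b x (stepR \<tau> \<rho> (precomp p \<sigma> f) (?W \<beta>'))) (stepLR e \<tau> b g \<rho> (?W \<beta>'))"
    using replace rewrite_derives[OF W] by blast
  moreover have "typed_par_R (stepR \<tau> \<rho> (precomp p \<sigma> f) (?W \<beta>')) (stepLR \<sigma> \<tau> \<pi> f \<rho> \<beta>')"
    using bifocus_cong[OF 1(1) rewrite_derives[OF \<beta>'(2)]] unfolding typed_par_R_def by blast
  ultimately have "rewrite_step p (Infer r \<gamma>) (stepLR e \<tau> b g \<rho> (?W \<beta>'))"
    using root_step_rewrite unfolding root_step_def typed_gra_L_def \<beta>'(1) by blast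
  moreover have "rewrite_step p Z (stepLR e \<tau> b g \<rho> (?W \<beta>'))"
    unfolding Z by (rule rewrite_Infer[OF rewrite_inv_stepI[OF W]])
  ultimately show ?thesis
    by blast
qed

lemma typed_gra_R_peak:
  assumes "typed_gra_R (Infer r \<alpha>) Z" "rewrite_step p \<alpha> \<gamma>"
  shows "\<exists>\<delta>. (rewrite_step p)\<^sup>*\<^sup>* Z \<delta> \<and> (rewrite_step p)\<^sup>*\<^sup>* (Infer r \<gamma>) \<delta>"
proof -
  obtain e d y X Y where XY: "typed_par_L X Y" "typed_par_R (stepR e d y X) Z" "Infer r \<alpha> = stepR e d y Y"
    using assms(1) unfolding typed_gra_R_def by blast
  obtain \<sigma> \<tau> \<pi> f \<rho> \<beta> s where 1: "bifocus \<sigma> \<tau> \<pi> f \<rho> \<beta> s" "Y = stepLR \<sigma> \<tau> \<pi> f \<rho> \<beta>"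
    "X = stepL \<sigma> \<pi> (postcomp p f \<tau>) (stepR \<tau> \<rho> (precomp p \<pi> f) \<beta>)"
    using XY(1) unfolding typed_par_L_def by blast
  obtain \<beta>' where \<beta>': "Infer r \<gamma> = stepR e d y (stepLR \<sigma> \<tau> \<pi> f \<rho> \<beta>')" "rewrite_step p \<beta> \<beta>'"
    using assms(2) XY(3) 1(2) by (auto elim!: rewrite_inv_stepE rewrite_stepLRE)
  let ?W = "stepR \<tau> \<rho> (precomp p \<pi> f)"
  obtain g where Z: "Z = stepLR \<sigma> e \<pi> g d (?W \<beta>)" and
    replace: "\<And>W'. (\<And>t. derives p (?W \<beta>) t \<Longrightarrow> derives p W' t) \<Longrightarrow>
      typed_par_R (stepR e d y (stepL \<sigma> \<pi> (postcomp p f \<tau>) W')) (stepLR \<sigma> e \<pi> g d W')"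
    using typed_par_R_shape[OF XY(2)[unfolded 1(3)]] by (metis inv_headed.simps(4))
  have W: "rewrite_step p (?W \<beta>) (?W \<beta>')"
    using \<beta>'(2) by (intro rewrite_Infer rewrite_inv_stepI)
  have "typed_par_R (stepR e d y (stepL \<sigma> \<pi> (postcomp p f \<tau>) (?W \<beta>'))) (stepLR \<sigma> e \<pi> g d (?W \<beta>'))"
    using replace rewrite_derives[OF W] by blast
  moreover have "typed_par_L (stepL \<sigma> \<pi> (postcomp p f \<tau>) (?W \<beta>')) (stepLR \<sigma> \<tau> \<pi> f \<rho> \<beta>')"
    using bifocus_cong[OF 1(1) rewrite_derives[OF \<beta>'(2)]] unfolding typed_par_L_def by blast
  ultimately have "rewrite_step p (Infer r \<gamma>) (stepLR \<sigma> e \<pi> g d (?W \<beta>'))"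
    using root_step_rewrite unfolding root_step_def typed_gra_R_def \<beta>'(1) by blast
  moreover have "rewrite_step p Z (stepLR \<sigma> e \<pi> g d (?W \<beta>'))"
    unfolding Z by (rule rewrite_Infer[OF rewrite_inv_stepI[OF W]])
  ultimately show ?thesis
    by blast
qed

lemma root_step_peak:
  assumes "root_step (Infer r \<alpha>) Z" "rewrite_step p \<alpha> \<gamma>"
  shows "\<exists>\<delta>. (rewrite_step p)\<^sup>*\<^sup>* Z \<delta> \<and> (rewrite_step p)\<^sup>*\<^sup>* (Infer r \<gamma>) \<delta>"
  using assms typed_par_L_peak typed_par_R_peak typed_gra_L_peak typed_gra_R_peak unfolding root_step_def by blast

lemma root_step_Infer: "root_step \<alpha> \<gamma> \<Longrightarrow> \<exists>r \<delta>. \<alpha> = Infer r \<delta>"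
  unfolding root_step_def using typed_par_L_head typed_par_R_head typed_gra_L_head typed_gra_R_head by blast

lemma typed_gra_L_functional:
  assumes "factorization_preordered (target p)" "typed_gra_L \<alpha> Z" "typed_gra_L \<alpha> Z'"
  shows "Z = Z'"
proof -
  obtain e b x X Y where 1: "typed_par_R X Y" "typed_par_L (stepL e b x X) Z" "\<alpha> = stepL e b x Y"
    using assms(2) unfolding typed_gra_L_def by blast
  obtain e' b' x' X' Y' where 2: "typed_par_R X' Y'" "typed_par_L (stepL e' b' x' X') Z'" "\<alpha> = stepL e' b' x' Y'"
    using assms(3) unfolding typed_gra_L_def by blast
  have Y: "\<not> inv_headed Y" "\<not> inv_headed Y'"
    using 1(1) 2(1) by (auto simp: typed_par_R_def)
  have e: "e = e'" and b: "inv_step b x [] Y = inv_step b' x' [] Y'"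
    using 1(3) 2(3) by simp_all
  note eq = e inv_step_eqD(3,4)[OF b Y]
  then have "X = X'"
    using typed_par_R_inj 1(1) 2(1) by blast
  with 1(2) 2(2) eq show ?thesis
    using typed_par_L_functional[OF assms(1)] by metis
qed

lemma typed_gra_R_functional:
  assumes "factorization_preordered (target p)" "typed_gra_R \<alpha> Z" "typed_gra_R \<alpha> Z'"
  shows "Z = Z'"
proof -
  obtain e b x X Y where 1: "typed_par_L X Y" "typed_par_R (stepR e b x X) Z" "\<alpha> = stepR e b x Y"
    using assms(2) unfolding typed_gra_R_def by blast
  obtain e' b' x' X' Y' where 2: "typed_par_L X' Y'" "typed_par_R (stepR e' b' x' X') Z'" "\<alpha> = stepR e' b' x' Y'"
    using assms(3) unfolding typed_gra_R_def by blast
  have Y: "\<not> inv_headed Y" "\<not> inv_headed Y'"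
    using 1(1) 2(1) by (auto simp: typed_par_L_def)
  have e: "e = e'" and b: "inv_step [] x b Y = inv_step [] x' b' Y'"
    using 1(3) 2(3) by simp_all
  note eq = e inv_step_eqD(3,4)[OF b Y]
  then have "X = X'"
    using typed_par_L_inj 1(1) 2(1) by blast
  with 1(2) 2(2) eq show ?thesis
    using typed_par_R_functional[OF assms(1)] by metis
qed

lemma typed_par_gra_L_disjoint: "\<not> (typed_par_L \<alpha> Z \<and> typed_gra_L \<alpha> Z')"
  by (auto simp: typed_par_L_def typed_gra_L_def typed_par_R_def dest: inv_step_eqD(3))

lemma typed_par_gra_R_disjoint: "\<not> (typed_par_R \<alpha> Z \<and> typed_gra_R \<alpha> Z')"
  by (auto simp: typed_par_L_def typed_gra_R_def typed_par_R_def dest: inv_step_eqD(3))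

lemma root_step_functional:
  assumes "factorization_preordered (target p)" "root_step \<alpha> Z" "root_step \<alpha> Z'"
  shows "Z = Z'"
proof -
  have "\<not> (\<alpha> = Infer (FocL \<sigma>) \<delta> \<and> \<alpha> = Infer (FocR \<sigma>') \<delta>')" for \<sigma> \<sigma>' \<delta> \<delta>'
    by auto
  then show ?thesis
    using assms(2,3) typed_par_L_functional[OF assms(1)] typed_par_R_functional[OF assms(1)]
      typed_gra_L_functional[OF assms(1)] typed_gra_R_functional[OF assms(1)]
      typed_par_gra_L_disjoint typed_par_gra_R_disjoint
      typed_par_L_head typed_par_R_head typed_gra_L_head typed_gra_R_head
    unfolding root_step_def by metis
qed

lemma rewrites_Infer:
  "(rewrite_step p)\<^sup>*\<^sup>* \<alpha> \<beta> \<Longrightarrow> (rewrite_step p)\<^sup>*\<^sup>* (Infer r \<alpha>) (Infer r \<beta>)"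
  by (induction rule: rtranclp_induct) (auto intro: rewrite_Infer rtranclp.rtrancl_into_rtrancl)

lemma local_confluence:
  assumes "factorization_preordered (target p)" "rewrite_step p \<alpha> \<beta>" "rewrite_step p \<alpha> \<gamma>"
  shows "\<exists>\<delta>. (rewrite_step p)\<^sup>*\<^sup>* \<beta> \<delta> \<and> (rewrite_step p)\<^sup>*\<^sup>* \<gamma> \<delta>"
  using assms(2,3)
proof (induction \<alpha> arbitrary: \<beta> \<gamma>)
  case (Axiom \<delta>)
  then show ?case
    by (metis derivation.distinct(1) rewrite_cases root_step_Infer)
next
  case (Infer r \<alpha>)
  from Infer.prems(1) show ?case
  proof (rule rewrite_cases)
    assume \<beta>: "root_step (Infer r \<alpha>) \<beta>"
    from Infer.prems(2) show ?case
    proof (rule rewrite_cases)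
      assume "root_step (Infer r \<alpha>) \<gamma>"
      with \<beta> root_step_functional[OF assms(1)] show ?case
        by blast
    qed (use \<beta> root_step_peak in auto)
  next
    fix r' \<alpha>' \<beta>'
    assume \<beta>: "Infer r \<alpha> = Infer r' \<alpha>'" "\<beta> = Infer r' \<beta>'" "rewrite_step p \<alpha>' \<beta>'"
    from Infer.prems(2) show ?case
    proof (rule rewrite_cases)
      assume "root_step (Infer r \<alpha>) \<gamma>"
      with \<beta> root_step_peak show ?case
        by blast
    next
      fix r'' \<alpha>'' \<gamma>'
      assume "Infer r \<alpha> = Infer r'' \<alpha>''" "\<gamma> = Infer r'' \<gamma>'" "rewrite_step p \<alpha>'' \<gamma>'"
      with \<beta> Infer.IH[of \<beta>' \<gamma>'] show ?case
        using rewrites_Infer by auto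
    qed
  qed
qed

end

text \<open>Inversions do not count.  Moving \<open>LR\<close> below \<open>L\<close> or \<open>R\<close> decreases the weight because
  \<open>2 w + 1 < 2 (w + 1)\<close>, and fusing \<open>L R\<close> or \<open>R L\<close> into \<open>LR\<close> does so because \<open>w + 1 < 4 w\<close> for
  positive \<open>w\<close>.\<close>

fun weight :: "('d, 'a) derivation \<Rightarrow> nat" where
  "weight (Axiom \<delta>) = 1"
| "weight (Infer (Inv \<pi> f \<rho>) \<alpha>) = weight \<alpha>"
| "weight (Infer (FocL \<sigma>) \<alpha>) = 2 * weight \<alpha>"
| "weight (Infer (FocR \<tau>) \<alpha>) = 2 * weight \<alpha>"
| "weight (Infer (FocLR \<sigma> \<tau>) \<alpha>) = weight \<alpha> + 1"

lemma weight_pos: "0 < weight \<alpha>"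
  by (induction \<alpha> rule: weight.induct) auto

lemma weight_inv_step [simp]: "weight (inv_step \<pi> f \<rho> \<alpha>) = weight \<alpha>"
  by (simp add: inv_step_def)

lemma weight_rewrite:
  fixes \<alpha> \<beta> :: "('d, 'a) derivation"
  shows "rewrite_step p \<alpha> \<beta> \<Longrightarrow> weight \<beta> < weight \<alpha>"
proof (induction rule: rewrite_step.induct)
  case (rewrite_root \<alpha> \<beta> s)
  have "weight \<gamma> + 1 < 4 * weight \<gamma>" for \<gamma> :: "('d, 'a) derivation"
    using weight_pos[of \<gamma>] by linarith
  with rewrite_root(1) show ?case
    by (auto elim!: par_rule.cases gra_rule.cases)
next
  case (rewrite_Infer \<alpha> \<beta> r)
  then show ?case by (cases r) auto
qed

context cat_functor
begin

section \<open>Normal forms and sequentialization equivalence\<close>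

lemma normal_form_exists: "derives p \<alpha> s \<Longrightarrow> \<exists>\<nu>. normal_form_of p \<alpha> \<nu>"
proof (induction \<alpha> rule: measure_induct_rule[of weight])
  case (less \<alpha>)
  show ?case
  proof (cases "\<exists>\<beta>. rewrite_step p \<alpha> \<beta>")
    case True
    then obtain \<beta> where "rewrite_step p \<alpha> \<beta>"
      by blast
    with less show ?thesis
      by (meson converse_rtranclp_into_rtranclp normal_form_of_def rewrite_derives weight_rewrite)
  next
    case False
    with less.prems show ?thesis
      unfolding normal_form_of_def normal_form_def by blast
  qed
qed

lemma normal_form_unique:
  assumes "factorization_preordered (target p)"
  shows "derives p \<alpha> s \<Longrightarrow> normal_form_of p \<alpha> \<nu> \<Longrightarrow> normal_form_of p \<alpha> \<mu> \<Longrightarrow> \<nu> = \<mu>"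
proof (induction \<alpha> arbitrary: \<nu> \<mu> rule: measure_induct_rule[of weight])
  case (less \<alpha>)
  show ?case
  proof (cases "\<exists>\<beta>. rewrite_step p \<alpha> \<beta>")
    case True
    then have "\<alpha> \<noteq> \<nu>" "\<alpha> \<noteq> \<mu>"
      using less.prems unfolding normal_form_of_def normal_form_def by blast+
    then obtain \<beta> \<gamma> where \<beta>: "rewrite_step p \<alpha> \<beta>" "normal_form_of p \<beta> \<nu>"
      and \<gamma>: "rewrite_step p \<alpha> \<gamma>" "normal_form_of p \<gamma> \<mu>"
      using less.prems unfolding normal_form_of_def by (metis converse_rtranclpE)
    obtain \<delta> where \<delta>: "(rewrite_step p)\<^sup>*\<^sup>* \<beta> \<delta>" "(rewrite_step p)\<^sup>*\<^sup>* \<gamma> \<delta>"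
      using local_confluence[OF assms \<beta>(1) \<gamma>(1)] by blast
    have d: "derives p \<beta> s" "derives p \<gamma> s"
      using \<beta>(1) \<gamma>(1) less.prems(1) rewrite_derives by blast+
    have "derives p \<delta> s"
      using \<delta>(1) d(1) by (induction rule: rtranclp_induct) (auto intro: rewrite_derives)
    then obtain \<kappa> where "normal_form_of p \<delta> \<kappa>"
      using normal_form_exists by blast
    with \<delta> have "normal_form_of p \<beta> \<kappa>" "normal_form_of p \<gamma> \<kappa>"
      unfolding normal_form_of_def by auto
    then show ?thesis
      using less.IH[OF weight_rewrite[OF \<beta>(1)] d(1)] less.IH[OF weight_rewrite[OF \<gamma>(1)] d(2)]
        \<beta>(2) \<gamma>(2) by metis
  next
    case False
    with less.prems(2,3) show ?thesis
      unfolding normal_form_of_def by (metis converse_rtranclpE)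
  qed
qed

lemma normal_form_ex1:
  "factorization_preordered (target p) \<Longrightarrow> derives p \<alpha> s \<Longrightarrow> \<exists>!\<nu>. normal_form_of p \<alpha> \<nu>"
  using normal_form_exists normal_form_unique by blast

lemma NF_normal_form_of:
  "factorization_preordered (target p) \<Longrightarrow> derives p \<alpha> s \<Longrightarrow> normal_form_of p \<alpha> (NF p \<alpha>)"
  unfolding NF_def using normal_form_ex1 by (rule theI')

lemma NF_rewrites:
  assumes "factorization_preordered (target p)" "derives p \<alpha> s" "derives p \<beta> s"
    and "(rewrite_step p)\<^sup>*\<^sup>* \<alpha> \<beta>"
  shows "NF p \<alpha> = NF p \<beta>"
proof -
  have "normal_form_of p \<alpha> (NF p \<beta>)"
    using NF_normal_form_of[OF assms(1,3)] assms(4) unfolding normal_form_of_def by auto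
  with NF_normal_form_of[OF assms(1,2)] show ?thesis
    using normal_form_unique[OF assms(1,2)] by blast
qed

lemma rewrites_derives: "(rewrite_step p)\<^sup>*\<^sup>* \<alpha> \<beta> \<Longrightarrow> derives p \<alpha> s \<Longrightarrow> derives p \<beta> s"
  by (induction rule: rtranclp_induct) (auto intro: rewrite_derives)

lemma seq_equiv_NF:
  assumes "factorization_preordered (target p)" "seq_equiv p s \<alpha> \<beta>"
  shows "NF p \<alpha> = NF p \<beta> \<and> derives p \<alpha> s \<and> derives p \<beta> s"
  using assms(2)
proof induction
  case (seq_par \<alpha> \<beta> s)
  then have "(rewrite_step p)\<^sup>*\<^sup>* \<alpha> \<beta>"
    by (blast intro: rewrite_root)
  with seq_par show ?case
    using NF_rewrites[OF assms(1)] by blast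
next
  case (seq_Infer s \<alpha> \<beta> r s')
  then have d: "derives p (Infer r \<alpha>) s'" "derives p (Infer r \<beta>) s'"
    by (auto intro: derives_Infer)
  have "(rewrite_step p)\<^sup>*\<^sup>* (Infer r \<alpha>) (Infer r (NF p \<alpha>))"
    "(rewrite_step p)\<^sup>*\<^sup>* (Infer r \<beta>) (Infer r (NF p \<alpha>))"
    using NF_normal_form_of[OF assms(1)] seq_Infer.IH rewrites_Infer
    unfolding normal_form_of_def by metis+
  with d show ?case
    using NF_rewrites[OF assms(1)] rewrites_derives by metis
qed auto

lemma seq_equiv_Infer:
  "(\<And>t. derives p \<alpha> t \<Longrightarrow> seq_equiv p t \<alpha> \<beta>) \<Longrightarrow> derives p (Infer r \<alpha>) s \<Longrightarrow>
   seq_equiv p s (Infer r \<alpha>) (Infer r \<beta>)"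
  by (auto elim!: derives_InferE intro: seq_Infer)

lemma seq_equiv_inv_step:
  "(\<And>t. derives p \<alpha> t \<Longrightarrow> seq_equiv p t \<alpha> \<beta>) \<Longrightarrow> derives p (inv_step \<pi> f \<rho> \<alpha>) s \<Longrightarrow>
   seq_equiv p s (inv_step \<pi> f \<rho> \<alpha>) (inv_step \<pi> f \<rho> \<beta>)"
  by (auto simp: inv_step_def intro: seq_equiv_Infer split: if_splits)

lemma typed_par_L_seq_equiv: "typed_par_L \<alpha> \<beta> \<Longrightarrow> derives p \<alpha> s \<Longrightarrow> seq_equiv p s \<alpha> \<beta>"
  using typed_par_L_is_par_rule typed_par_L_iff seq_par by blast

lemma typed_par_R_seq_equiv: "typed_par_R \<alpha> \<beta> \<Longrightarrow> derives p \<alpha> s \<Longrightarrow> seq_equiv p s \<alpha> \<beta>"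
  using typed_par_R_is_par_rule typed_par_R_iff seq_par by blast

lemma rewrite_seq_equiv: "rewrite_step p \<alpha> \<beta> \<Longrightarrow> derives p \<alpha> s \<Longrightarrow> seq_equiv p s \<alpha> \<beta>"
proof (induction arbitrary: s rule: rewrite_step.induct)
  case (rewrite_root \<alpha> \<beta> t)
  then have "root_step \<alpha> \<beta>"
    using root_step_iff by blast
  then consider "typed_par_L \<alpha> \<beta>" | "typed_par_R \<alpha> \<beta>" | "typed_gra_L \<alpha> \<beta>" | "typed_gra_R \<alpha> \<beta>"
    unfolding root_step_def by blast
  then show ?case
  proof cases
    case 3
    \<comment> \<open>A \<open>gra\<close> step is the inverse of one \<open>par\<close> step followed by another \<open>par\<close> step.\<close>
    then obtain e b x X Y where XY: "typed_par_R X Y" "typed_par_L (stepL e b x X) \<beta>" "\<alpha> = stepL e b x Y"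
      unfolding typed_gra_L_def by blast
    have d: "derives p (stepL e b x X) s"
      using typed_par_R_iff[OF XY(1)] rewrite_root.prems XY(3) derives_Infer_cong derives_inv_step_cong
      by metis
    have "seq_equiv p s (stepL e b x X) \<alpha>"
      unfolding XY(3) by (rule seq_equiv_Infer[OF seq_equiv_inv_step[OF typed_par_R_seq_equiv[OF XY(1)]] d])
    then show ?thesis
      using typed_par_L_seq_equiv[OF XY(2) d] seq_sym seq_trans by metis
  next
    case 4
    then obtain e d y X Y where XY: "typed_par_L X Y" "typed_par_R (stepR e d y X) \<beta>" "\<alpha> = stepR e d y Y"
      unfolding typed_gra_R_def by blast
    have d: "derives p (stepR e d y X) s"
      using typed_par_L_iff[OF XY(1)] rewrite_root.prems XY(3) derives_Infer_cong derives_inv_step_cong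
      by metis
    have "seq_equiv p s (stepR e d y X) \<alpha>"
      unfolding XY(3) by (rule seq_equiv_Infer[OF seq_equiv_inv_step[OF typed_par_L_seq_equiv[OF XY(1)]] d])
    then show ?thesis
      using typed_par_R_seq_equiv[OF XY(2) d] seq_sym seq_trans by metis
  qed (use rewrite_root.prems typed_par_L_seq_equiv typed_par_R_seq_equiv in blast)+
next
  case (rewrite_Infer \<alpha> \<beta> r)
  then show ?case
    by (intro seq_equiv_Infer) auto
qed

lemma rewrites_seq_equiv: "(rewrite_step p)\<^sup>*\<^sup>* \<alpha> \<beta> \<Longrightarrow> derives p \<alpha> s \<Longrightarrow> seq_equiv p s \<alpha> \<beta>"
proof (induction rule: rtranclp_induct)
  case (step \<beta> \<gamma>)
  then show ?case
    using rewrite_seq_equiv rewrites_derives seq_trans by metis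
qed (rule seq_refl)

end

theorem theorem3p23:
  fixes p :: "('x, 'd, 'o, 'a) functor_data"
  assumes "cat_functor p"
    and "factorization_preordered (target p)"
  shows "(\<forall>\<alpha> (s :: ('x, 'a) sequent). derives p \<alpha> s \<longrightarrow> (\<exists>!\<nu>. normal_form_of p \<alpha> \<nu>)) \<and>
    (\<forall>\<alpha> \<beta> (s :: ('x, 'a) sequent). derives p \<alpha> s \<longrightarrow> derives p \<beta> s \<longrightarrow>
      (seq_equiv p s \<alpha> \<beta> \<longleftrightarrow> NF p \<alpha> = NF p \<beta>))"
proof -
  interpret cat_functor p
    by (rule assms(1))
  have "seq_equiv p s \<alpha> \<beta>"
    if "derives p \<alpha> s" "derives p \<beta> s" "NF p \<alpha> = NF p \<beta>" for \<alpha> \<beta> and s :: "('x, 'a) sequent"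
  proof -
    have "seq_equiv p s \<alpha> (NF p \<alpha>)" "seq_equiv p s \<beta> (NF p \<alpha>)"
      using that NF_normal_form_of[OF assms(2)] rewrites_seq_equiv
      unfolding normal_form_of_def by metis+
    then show ?thesis
      using seq_sym seq_trans by metis
  qed
  then show ?thesis
    using normal_form_ex1[OF assms(2)] seq_equiv_NF[OF assms(2)] by blast
qed

end
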